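(* Let $X$ be a topological space and $n\ge 0$ an integer. The filtration of the singular homology group $H_n(X,\mathbb R)$ by the $\mathfrak s$-modules $H_n(X,\Vert H\mathbb R\Vert_\lambda)$, $\lambda>0$ (that is, by the ranges of the canonical maps $H_n(X,\Vert H\mathbb R\Vert_\lambda)(1_+)\to H_n(X,\mathbb R)$), defines a semi-norm $$\alpha\mapsto \inf\{\lambda>0\mid \alpha\in \mathrm{Range}\big(H_n(X,\Vert H\mathbb R\Vert_\lambda)(1_+)\to H_n(X,\mathbb R)\big)\}$$ on $H_n(X,\mathbb R)$ which is equivalent to the Gromov norm (the $\ell^1$-semi-norm on singular homology).
   Context: $\Gamma^{\rm op}$ is the category of pointed finite sets $k_+=\{0,1,\dots,k\}$ ($k\ge 0$, base point $0$) with base-point preserving maps. An $\mathfrak s$-module is a pointed covariant functor $M:\Gamma^{\rm op}\to \mathrm{Sets}_*$; it is extended to an endofunctor of pointed sets by filtered colimits over finite pointed subsets. For a pointed simplicial set $X$, $M\circ X$ is the pointed simplicial set $[q]\mapsto M(X_q)$. $H\mathbb R$ is the $\mathfrak s$-module $H\mathbb R(k_+)=\mathbb R^k$ with $H\mathbb R(f)(m)(j)=\sum_{f(\ell)=j}m_\ell$ for $j\neq 0$. As an endofunctor, $H\mathbb R(E)$ is the set of finitely supported maps $\phi:E\to\mathbb R$ vanishing at the base point. For $\lambda>0$, $\Vert H\mathbb R\Vert_\lambda\subset H\mathbb R$ is the sub-$\mathfrak s$-module given (as an endofunctor) by those $\phi$ with $\sum_x|\phi(x)|<\lambda$. For a pointed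 simplicial set $Y$ with base point $*$ and $n\ge0$, let $Z_n(Y)=\{x\in Y_n\mid \partial_jx=*\ \forall j\}$ (no condition if $n=0$), with relation $xRy$ iff there is $z\in Y_{n+1}$ with $\partial_jz=*$ for $j<n$, $\partial_nz=x$, $\partial_{n+1}z=y$; $\pi^{\rm comb}_n(Y)$ is the quotient of $Z_n(Y)$ by the equivalence relation generated by $R$. For a pointed simplicial set $X$ and an $\mathfrak s$-module $M$, $H_n(X,M)$ is the $\mathfrak s$-module $k_+\mapsto \pi_n^{\rm comb}(M\circ(X\wedge k_+))$. For a topological space $X$, $H_n(X,M):=H_n(\sin X,M)$, where $\sin X=\{[n]\mapsto \mathrm{Top}(\Delta^n,X)\}$ is the singular simplicial set, made pointed by adjoining a disjoint base point. The canonical map $H_n(X,\Vert H\mathbb R\Vert_\lambda)(1_+)\to H_n(X,\mathbb R)$ is induced by the inclusion $\Vert H\mathbb R\Vert_\lambda\subset H\mathbb R$ and sends the class of a singular chain $\phi$ with all faces $\partial_j\phi=0$ to its singular homology class. The Gromov (semi-)norm of $\alpha\in H_n(X,\mathbb R)$ is $\Vert\alpha\Vert_1=\inf_c\Vert c\Vert_1$ over all singular cycles $c=\sum a_j\sigma_j$ (distinct $\sigma_j$) representing $\alpha$, where $\Vert c\Vert_1=\sum|a_j|$. Two semi-norms are equivalent if each is bounded by a constant multiple of the other. *)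

theory Defs
  imports "HOL-Homology.Homology"
begin

section \<open>\<open>\<s>\<close>-modules\<close>

text \<open>
  The object \<open>k\<^sub>+\<close> of \<open>\<Gamma>\<^sup>o\<^sup>p\<close> is \<open>{..k}\<close> with base point 0. Morphisms are represented by total
  functions on \<open>nat\<close>, of which only the values on \<open>{..k}\<close> matter.
\<close>

definition gamma_hom :: "nat \<Rightarrow> nat \<Rightarrow> (nat \<Rightarrow> nat) set" where
  "gamma_hom k l = {g. g 0 = 0 \<and> g ` {..k} \<subseteq> {..l}}"

record 'm smodule =
  sm_ob :: "nat \<Rightarrow> 'm set"
  sm_pt :: "nat \<Rightarrow> 'm"
  sm_map :: "nat \<Rightarrow> nat \<Rightarrow> (nat \<Rightarrow> nat) \<Rightarrow> 'm \<Rightarrow> 'm"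

definition s_module :: "'m smodule \<Rightarrow> bool" where
  "s_module M \<longleftrightarrow>
     sm_ob M 0 = {sm_pt M 0} \<and>
     (\<forall>k. sm_pt M k \<in> sm_ob M k) \<and>
     (\<forall>k l g. g \<in> gamma_hom k l \<longrightarrow>
        sm_map M k l g ` sm_ob M k \<subseteq> sm_ob M l \<and> sm_map M k l g (sm_pt M k) = sm_pt M l) \<and>
     (\<forall>k l g g'. g \<in> gamma_hom k l \<and> g' \<in> gamma_hom k l \<and> (\<forall>i\<le>k. g i = g' i) \<longrightarrow>
        (\<forall>m\<in>sm_ob M k. sm_map M k l g m = sm_map M k l g' m)) \<and>
     (\<forall>k. \<forall>m\<in>sm_ob M k. sm_map M k k id m = m) \<and>
     (\<forall>k l p g h. g \<in> gamma_hom k l \<and> h \<in> gamma_hom l p \<longrightarrow>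
        (\<forall>m\<in>sm_ob M k. sm_map M k p (h \<circ> g) m = sm_map M l p h (sm_map M k l g m)))"

text \<open>
  An element of \<open>\<real>\<^sup>k = HR(k\<^sub>+)\<close> is a function on \<open>nat\<close> vanishing outside \<open>{1..k}\<close>.
\<close>

definition HR :: "(nat \<Rightarrow> real) smodule" where
  "HR = \<lparr>sm_ob = (\<lambda>k. {m. \<forall>j. j \<notin> {1..k} \<longrightarrow> m j = 0}),
         sm_pt = (\<lambda>k j. 0),
         sm_map = (\<lambda>k l g m j. if j \<in> {1..l} then (\<Sum>i\<in>{i\<in>{1..k}. g i = j}. m i) else 0)\<rparr>"

definition norm_HR :: "real \<Rightarrow> (nat \<Rightarrow> real) smodule" where
  "norm_HR r = HR\<lparr>sm_ob := (\<lambda>k. {m \<in> sm_ob HR k. (\<Sum>j=1..k. \<bar>m j\<bar>) < r})\<rparr>"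

subsection \<open>Extension to pointed sets by filtered colimits\<close>

text \<open>
  The value of \<open>M\<close> on a pointed set \<open>(E,e)\<close> is the colimit of \<open>M(F)\<close> over the finite pointed subsets
  \<open>F\<close> of \<open>E\<close>. A finite pointed subset is presented by an enumeration, i.e. an injective pointed map
  \<open>f: k\<^sub>+ \<rightarrow> E\<close> with image \<open>F\<close>, which also identifies \<open>M(F)\<close> with \<open>M(k\<^sub>+)\<close>. An element of the colimit
  is thus a class of triples \<open>(k,f,m)\<close> with \<open>m \<in> M(k\<^sub>+)\<close>, and two triples are identified iff their
  images agree in \<open>M(F)\<close> for some larger \<open>F\<close>.
\<close>

definition enumerates :: "'e set \<Rightarrow> 'e \<Rightarrow> nat \<Rightarrow> (nat \<Rightarrow> 'e) \<Rightarrow> bool" where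
  "enumerates E e k f \<longleftrightarrow> f 0 = e \<and> f ` {..k} \<subseteq> E \<and> inj_on f {..k}"

definition colim_rep :: "'m smodule \<Rightarrow> 'e set \<Rightarrow> 'e \<Rightarrow> (nat \<times> (nat \<Rightarrow> 'e) \<times> 'm) set" where
  "colim_rep M E e = {(k, f, m). enumerates E e k f \<and> m \<in> sm_ob M k}"

text \<open>The maps \<open>f, f'\<close> below need not be injective; this is used for functoriality in \<open>E\<close>.\<close>

definition colim_glue :: "'m smodule \<Rightarrow> 'e set \<Rightarrow> 'e \<Rightarrow>
    nat \<times> (nat \<Rightarrow> 'e) \<times> 'm \<Rightarrow> nat \<times> (nat \<Rightarrow> 'e) \<times> 'm \<Rightarrow> bool" where
  "colim_glue M E e = (\<lambda>(k, f, m) (k', f', m').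
     \<exists>p u g g'. enumerates E e p u \<and> g \<in> gamma_hom k p \<and> g' \<in> gamma_hom k' p \<and>
       (\<forall>i\<le>k. f i = u (g i)) \<and> (\<forall>i\<le>k'. f' i = u (g' i)) \<and>
       sm_map M k p g m = sm_map M k' p g' m')"

definition colim_class :: "'m smodule \<Rightarrow> 'e set \<Rightarrow> 'e \<Rightarrow>
    nat \<times> (nat \<Rightarrow> 'e) \<times> 'm \<Rightarrow> (nat \<times> (nat \<Rightarrow> 'e) \<times> 'm) set" where
  "colim_class M E e s = {t \<in> colim_rep M E e. colim_glue M E e s t}"

definition sm_ext :: "'m smodule \<Rightarrow> 'e set \<Rightarrow> 'e \<Rightarrow> (nat \<times> (nat \<Rightarrow> 'e) \<times> 'm) set set" where
  "sm_ext M E e = colim_class M E e ` colim_rep M E e"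

definition sm_ext_pt :: "'m smodule \<Rightarrow> 'e set \<Rightarrow> 'e \<Rightarrow> (nat \<times> (nat \<Rightarrow> 'e) \<times> 'm) set" where
  "sm_ext_pt M E e = colim_class M E e (0, (\<lambda>_. e), sm_pt M 0)"

text \<open>The map \<open>M(E) \<rightarrow> M(E')\<close> induced by a pointed map \<open>\<phi>: (E,e) \<rightarrow> (E',e')\<close>.\<close>

definition sm_ext_map :: "'m smodule \<Rightarrow> 'd set \<Rightarrow> 'd \<Rightarrow> ('e \<Rightarrow> 'd) \<Rightarrow>
    (nat \<times> (nat \<Rightarrow> 'e) \<times> 'm) set \<Rightarrow> (nat \<times> (nat \<Rightarrow> 'd) \<times> 'm) set" where
  "sm_ext_map M E' e' \<phi> c = (\<Union>(k, f, m)\<in>c. colim_class M E' e' (k, \<phi> \<circ> f, m))"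


section \<open>Pointed simplicial sets\<close>

text \<open>
  \<open>act Y p q \<theta>: Y\<^sub>q \<rightarrow> Y\<^sub>p\<close> is the map induced by a weakly increasing \<open>\<theta>: {..p} \<rightarrow> {..q}\<close>.
\<close>

record 'x psset =
  simplices :: "nat \<Rightarrow> 'x set"
  pt :: "nat \<Rightarrow> 'x"
  act :: "nat \<Rightarrow> nat \<Rightarrow> (nat \<Rightarrow> nat) \<Rightarrow> 'x \<Rightarrow> 'x"

definition coface :: "nat \<Rightarrow> nat \<Rightarrow> nat" where
  "coface j i = (if i < j then i else Suc i)"

text \<open>\<open>face Y q j: Y\<^bsub>q+1\<^esub> \<rightarrow> Y\<^sub>q\<close> is the face map \<open>\<partial>\<^sub>j\<close>.\<close>

definition face :: "'x psset \<Rightarrow> nat \<Rightarrow> nat \<Rightarrow> 'x \<Rightarrow> 'x" where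
  "face Y q j = act Y q (Suc q) (coface j)"

definition smash_norm :: "'x \<Rightarrow> 'x \<times> nat \<Rightarrow> 'x \<times> nat" where
  "smash_norm b = (\<lambda>(x, i). if x = b \<or> i = 0 then (b, 0) else (x, i))"

text \<open>
  \<open>smash Y k\<close> is \<open>Y \<and> k\<^sub>+\<close>: the pairs \<open>(x,i)\<close> with \<open>x\<close> or \<open>i\<close> a base point are collapsed to the
  single pair of base points.
\<close>

definition smash :: "'x psset \<Rightarrow> nat \<Rightarrow> ('x \<times> nat) psset" where
  "smash Y k =
     \<lparr>simplices = (\<lambda>q. smash_norm (pt Y q) ` (simplices Y q \<times> {..k})),
      pt = (\<lambda>q. (pt Y q, 0)),
      act = (\<lambda>p q \<theta> (x, i). smash_norm (pt Y p) (act Y p q \<theta> x, i))\<rparr>"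

definition sm_comp :: "'m smodule \<Rightarrow> 'x psset \<Rightarrow> (nat \<times> (nat \<Rightarrow> 'x) \<times> 'm) set psset" where
  "sm_comp M Y =
     \<lparr>simplices = (\<lambda>q. sm_ext M (simplices Y q) (pt Y q)),
      pt = (\<lambda>q. sm_ext_pt M (simplices Y q) (pt Y q)),
      act = (\<lambda>p q \<theta>. sm_ext_map M (simplices Y p) (pt Y p) (act Y p q \<theta>))\<rparr>"

subsection \<open>Combinatorial homotopy\<close>

definition Zcomb :: "'x psset \<Rightarrow> nat \<Rightarrow> 'x set" where
  "Zcomb Y n = {x \<in> simplices Y n. n = 0 \<or> (\<forall>j\<le>n. face Y (n - 1) j x = pt Y (n - 1))}"

definition Rcomb :: "'x psset \<Rightarrow> nat \<Rightarrow> 'x \<Rightarrow> 'x \<Rightarrow> bool" where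
  "Rcomb Y n x y \<longleftrightarrow> x \<in> Zcomb Y n \<and> y \<in> Zcomb Y n \<and>
     (\<exists>z\<in>simplices Y (Suc n). (\<forall>j<n. face Y n j z = pt Y n) \<and>
        face Y n n z = x \<and> face Y n (Suc n) z = y)"

definition comb_class :: "'x psset \<Rightarrow> nat \<Rightarrow> 'x \<Rightarrow> 'x set" where
  "comb_class Y n x = {y \<in> Zcomb Y n. equivclp (Rcomb Y n) x y}"

definition pi_comb :: "'x psset \<Rightarrow> nat \<Rightarrow> 'x set set" where
  "pi_comb Y n = comb_class Y n ` Zcomb Y n"

text \<open>
  The \<open>\<s>\<close>-module \<open>H\<^sub>n(Y,M)\<close>, \<open>k\<^sub>+ \<mapsto> \<pi>\<^sub>n(M \<circ> (Y \<and> k\<^sub>+))\<close>; the map attached to \<open>g: k\<^sub>+ \<rightarrow> l\<^sub>+\<close> is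
  induced by \<open>id \<and> g\<close>.
\<close>

definition Hn :: "nat \<Rightarrow> 'x psset \<Rightarrow> 'm smodule \<Rightarrow>
    (nat \<times> (nat \<Rightarrow> 'x \<times> nat) \<times> 'm) set set smodule" where
  "Hn n Y M =
     \<lparr>sm_ob = (\<lambda>k. pi_comb (sm_comp M (smash Y k)) n),
      sm_pt = (\<lambda>k. comb_class (sm_comp M (smash Y k)) n (pt (sm_comp M (smash Y k)) n)),
      sm_map = (\<lambda>k l g C. \<Union>z\<in>C. comb_class (sm_comp M (smash Y l)) n
        (sm_ext_map M (simplices (smash Y l) n) (pt (smash Y l) n)
           (\<lambda>(x, i). smash_norm (pt Y n) (x, g i)) z))\<rparr>"

subsection \<open>The singular simplicial set, with a disjoint base point\<close>

definition simplex_map :: "nat \<Rightarrow> (nat \<Rightarrow> nat) \<Rightarrow> (nat \<Rightarrow> real) \<Rightarrow> (nat \<Rightarrow> real)" where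
  "simplex_map p \<theta> x = (\<lambda>j. \<Sum>i\<in>{i\<in>{..p}. \<theta> i = j}. x i)"

definition sing_plus :: "'a topology \<Rightarrow> ((nat \<Rightarrow> real) \<Rightarrow> 'a) option psset" where
  "sing_plus X =
     \<lparr>simplices = (\<lambda>q. insert None (Some ` {\<sigma>. singular_simplex q X \<sigma>})),
      pt = (\<lambda>q. None),
      act = (\<lambda>p q \<theta>. map_option (\<lambda>\<sigma>. restrict (\<sigma> \<circ> simplex_map p \<theta>) (standard_simplex p)))\<rparr>"


section \<open>Singular homology with real coefficients\<close>

text \<open>The library's singular homology has integer coefficients; the same definitions are repeated over \<open>\<real>\<close>.\<close>

type_synonym 'a rchain = "((nat \<Rightarrow> real) \<Rightarrow> 'a) \<Rightarrow>\<^sub>0 real"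

definition rchains :: "nat \<Rightarrow> 'a topology \<Rightarrow> 'a rchain set" where
  "rchains n X = {c. \<forall>\<sigma>\<in>Poly_Mapping.keys c. singular_simplex n X \<sigma>}"

definition rboundary :: "nat \<Rightarrow> 'a rchain \<Rightarrow> 'a rchain" where
  "rboundary n c =
     (if n = 0 then 0
      else \<Sum>\<sigma>\<in>Poly_Mapping.keys c. \<Sum>j\<le>n.
             Poly_Mapping.single (singular_face n j \<sigma>) ((-1) ^ j * Poly_Mapping.lookup c \<sigma>))"

definition rcycles :: "nat \<Rightarrow> 'a topology \<Rightarrow> 'a rchain set" where
  "rcycles n X = {c \<in> rchains n X. rboundary n c = 0}"

definition rboundaries :: "nat \<Rightarrow> 'a topology \<Rightarrow> 'a rchain set" where
  "rboundaries n X = rboundary (Suc n) ` rchains (Suc n) X"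

definition hclass :: "nat \<Rightarrow> 'a topology \<Rightarrow> 'a rchain \<Rightarrow> 'a rchain set" where
  "hclass n X c = {c' \<in> rcycles n X. c' - c \<in> rboundaries n X}"

definition rhomology :: "nat \<Rightarrow> 'a topology \<Rightarrow> 'a rchain set set" where
  "rhomology n X = hclass n X ` rcycles n X"

definition hadd :: "nat \<Rightarrow> 'a topology \<Rightarrow> 'a rchain set \<Rightarrow> 'a rchain set \<Rightarrow> 'a rchain set" where
  "hadd n X \<alpha> \<beta> = (\<Union>a\<in>\<alpha>. \<Union>b\<in>\<beta>. hclass n X (a + b))"

definition hscale :: "nat \<Rightarrow> 'a topology \<Rightarrow> real \<Rightarrow> 'a rchain set \<Rightarrow> 'a rchain set" where
  "hscale n X t \<alpha> = (\<Union>a\<in>\<alpha>. hclass n X (Poly_Mapping.map ((*) t) a))"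

definition l1norm :: "'a rchain \<Rightarrow> real" where
  "l1norm c = (\<Sum>\<sigma>\<in>Poly_Mapping.keys c. \<bar>Poly_Mapping.lookup c \<sigma>\<bar>)"

text \<open>A homology class is the set of all cycles representing it.\<close>

definition gromov_norm :: "'a rchain set \<Rightarrow> real" where
  "gromov_norm \<alpha> = Inf (l1norm ` \<alpha>)"


section \<open>The filtration of singular homology\<close>

text \<open>
  The class of a triple \<open>(k,f,m)\<close> in the value of \<open>HR\<close> at \<open>(sin X)\<^sub>n \<and> 1\<^sub>+\<close> is the finitely supported
  function \<open>\<Sum> m\<^sub>i f(i)\<close>; since \<open>f\<close> is injective and pointed, \<open>f i = (Some \<sigma>\<^sub>i, 1)\<close> for \<open>i \<ge> 1\<close>.
\<close>

definition chain_of :: "(nat \<times> (nat \<Rightarrow> ((nat \<Rightarrow> real) \<Rightarrow> 'a) option \<times> nat) \<times> (nat \<Rightarrow> real)) set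
    \<Rightarrow> 'a rchain" where
  "chain_of z = the_elem ((\<lambda>(k, f, m). \<Sum>i=1..k. Poly_Mapping.single (the (fst (f i))) (m i)) ` z)"

definition canonical_map :: "nat \<Rightarrow> 'a topology \<Rightarrow>
    (nat \<times> (nat \<Rightarrow> ((nat \<Rightarrow> real) \<Rightarrow> 'a) option \<times> nat) \<times> (nat \<Rightarrow> real)) set set
    \<Rightarrow> 'a rchain set" where
  "canonical_map n X C = (\<Union>z\<in>C. hclass n X (chain_of z))"

definition filt :: "nat \<Rightarrow> 'a topology \<Rightarrow> real \<Rightarrow> 'a rchain set set" where
  "filt n X r = canonical_map n X ` sm_ob (Hn n (sing_plus X) (norm_HR r)) 1"

definition filt_norm :: "nat \<Rightarrow> 'a topology \<Rightarrow> 'a rchain set \<Rightarrow> real" where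
  "filt_norm n X \<alpha> = Inf {r. 0 < r \<and> \<alpha> \<in> filt n X r}"

definition seminorm_on :: "'v set \<Rightarrow> ('v \<Rightarrow> 'v \<Rightarrow> 'v) \<Rightarrow> (real \<Rightarrow> 'v \<Rightarrow> 'v) \<Rightarrow> ('v \<Rightarrow> real) \<Rightarrow> bool" where
  "seminorm_on V plus_V scale_V N \<longleftrightarrow>
     (\<forall>v\<in>V. 0 \<le> N v) \<and>
     (\<forall>v\<in>V. \<forall>t. N (scale_V t v) = \<bar>t\<bar> * N v) \<and>
     (\<forall>v\<in>V. \<forall>w\<in>V. N (plus_V v w) \<le> N v + N w)"

definition equivalent_seminorms :: "'v set \<Rightarrow> ('v \<Rightarrow> real) \<Rightarrow> ('v \<Rightarrow> real) \<Rightarrow> bool" where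
  "equivalent_seminorms V N N' \<longleftrightarrow>
     (\<exists>A>0. \<forall>v\<in>V. N v \<le> A * N' v) \<and> (\<exists>B>0. \<forall>v\<in>V. N' v \<le> B * N v)"


section \<open>Functoriality and comparison with the library faces\<close>

lemma sum_fibre:
  fixes m :: "nat \<Rightarrow> real"
  assumes "finite J" "finite I" "g ` I \<subseteq> J"
  shows "(\<Sum>j\<in>J. \<Sum>i\<in>{i\<in>I. g i = j}. m i) = (\<Sum>i\<in>I. m i)"
  using sum.group[OF assms(2,1,3), of m] by simp

lemma s_module_HR: "s_module HR"
proof -
  have comp: "(\<Sum>i\<in>{i\<in>{1..k}. h (g i) = j}. m i) =
       (\<Sum>i\<in>{i\<in>{1..l}. h i = j}. \<Sum>i'\<in>{i'\<in>{1..k}. g i' = i}. m i')"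
    if g: "g \<in> gamma_hom k l" and h: "h \<in> gamma_hom l p" and j: "1 \<le> j"
    for k l p j g h and m :: "nat \<Rightarrow> real"
  proof -
    let ?I = "{i\<in>{1..k}. h (g i) = j}" and ?J = "{i\<in>{1..l}. h i = j}"
    have "g i \<in> ?J" if "i \<in> ?I" for i
    proof -
      have "g i \<le> l" "h 0 = 0" using that g h by (auto simp: gamma_hom_def)
      then show ?thesis using that j by (cases "g i") auto
    qed
    then have "(\<Sum>i\<in>?I. m i) = (\<Sum>i\<in>?J. \<Sum>i'\<in>{i'\<in>?I. g i' = i}. m i')"
      by (intro sum_fibre[symmetric]) auto
    also have "\<dots> = (\<Sum>i\<in>?J. \<Sum>i'\<in>{i'\<in>{1..k}. g i' = i}. m i')"
      by (intro sum.cong) auto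
    finally show ?thesis .
  qed
  have idm: "(\<lambda>j. if j \<in> {1..k} then \<Sum>i\<in>{i\<in>{1..k}. id i = j}. m i else 0) = m"
    if "\<forall>j. j \<notin> {1..k} \<longrightarrow> m j = 0" for k and m :: "nat \<Rightarrow> real"
  proof
    fix j
    have "{i\<in>{1..k}. id i = j} = (if j \<in> {1..k} then {j} else {})" by auto
    then show "(if j \<in> {1..k} then \<Sum>i\<in>{i\<in>{1..k}. id i = j}. m i else 0) = m j"
      using that by auto
  qed
  show ?thesis
    unfolding s_module_def
  proof (intro conjI allI impI ballI)
    fix k l p g h m
    assume "g \<in> gamma_hom k l \<and> h \<in> gamma_hom l p" "m \<in> sm_ob HR k"
    then show "sm_map HR k p (h \<circ> g) m = sm_map HR l p h (sm_map HR k l g m)"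
      using comp[of g k l h p _ m] by (intro ext) (simp add: HR_def)
  next
    fix k m assume "m \<in> sm_ob HR k"
    then show "sm_map HR k k id m = m" using idm by (simp add: HR_def)
  next
    fix k l g g' m
    assume "g \<in> gamma_hom k l \<and> g' \<in> gamma_hom k l \<and> (\<forall>i\<le>k. g i = g' i)"
    then show "sm_map HR k l g m = sm_map HR k l g' m"
      by (auto simp: HR_def intro!: ext sum.cong)
  qed (auto simp: HR_def)
qed

lemma norm_HR_map:
  assumes "g \<in> gamma_hom k l" "m \<in> sm_ob (norm_HR r) k"
  shows "sm_map HR k l g m \<in> sm_ob (norm_HR r) l"
proof -
  let ?I = "{i\<in>{1..k}. g i \<in> {1..l}}"
  have "(\<Sum>j=1..l. \<bar>sm_map HR k l g m j\<bar>) \<le> (\<Sum>j=1..l. \<Sum>i\<in>{i\<in>{1..k}. g i = j}. \<bar>m i\<bar>)"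
    by (auto simp: HR_def intro!: sum_mono sum_abs)
  also have "\<dots> = (\<Sum>j=1..l. \<Sum>i\<in>{i\<in>?I. g i = j}. \<bar>m i\<bar>)"
    by (intro sum.cong) auto
  also have "\<dots> = (\<Sum>i\<in>?I. \<bar>m i\<bar>)" by (intro sum_fibre) auto
  also have "\<dots> \<le> (\<Sum>i=1..k. \<bar>m i\<bar>)" by (intro sum_mono2) auto
  also have "\<dots> < r" using assms by (simp add: norm_HR_def)
  finally show ?thesis by (auto simp: norm_HR_def HR_def)
qed

lemma s_module_norm_HR:
  assumes "0 < r"
  shows "s_module (norm_HR r)"
proof -
  have *: "sm_map (norm_HR r) = sm_map HR" "sm_pt (norm_HR r) = sm_pt HR"
    "\<And>k. sm_ob (norm_HR r) k \<subseteq> sm_ob HR k"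
    by (auto simp: norm_HR_def)
  have pt: "sm_pt HR k \<in> sm_ob (norm_HR r) k" for k
    using assms by (simp add: norm_HR_def HR_def)
  have "sm_ob (norm_HR r) 0 = {sm_pt HR 0}"
    using s_module_HR pt[of 0] *(3)[of 0] by (auto simp: s_module_def)
  moreover have "m \<in> sm_ob HR k" if "m \<in> sm_ob (norm_HR r) k" for m k
    using that *(3) by blast
  ultimately show ?thesis
    using s_module_HR pt norm_HR_map
    unfolding s_module_def *(1,2) image_subset_iff by simp
qed

lemma face_sing_plus:
  assumes "j \<le> Suc q"
  shows "face (sing_plus X) q j (Some \<sigma>) = Some (singular_face (Suc q) j \<sigma>)"
proof -
  have "simplex_map q (coface j) x = simplical_face j x" if "x \<in> standard_simplex q" for x
  proof
    fix i
    have "{a\<in>{..q}. coface j a = i} =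
        (if i = j \<or> i > Suc q then {} else {if i < j then i else i - 1})"
      using assms by (auto simp: coface_def split: if_splits)
    then show "simplex_map q (coface j) x i = simplical_face j x i"
      using that assms
      by (auto simp: simplex_map_def simplical_face_def standard_simplex_def)
  qed
  then show ?thesis
    by (auto simp: face_def sing_plus_def singular_face_def intro!: restrict_ext)
qed

end

theory Submission
  imports Defs
begin

text \<open>
  An element of \<open>\<parallel>HR\<parallel>\<^sub>r\<close> at the pointed set of singular \<open>q\<close>-simplices is the same as a chain of
  \<open>\<ell>\<^sup>1\<close>-norm less than \<open>r\<close>. Hence a class lies in the step \<open>r\<close> of the filtration iff it is represented
  by a chain of norm less than \<open>r\<close> all of whose faces vanish, and the Gromov norm is bounded by the norm
  of the filtration. Conversely, if \<open>c\<close> is a cycle with \<open>\<partial>\<^sub>i c = 0\<close> for \<open>i < k\<close>, then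
  \<open>\<partial> (s\<^sub>k c) = (-1)\<^sup>k s\<^sub>k (\<partial>\<^sub>k c)\<close>, so that \<open>c - s\<^sub>k (\<partial>\<^sub>k c)\<close> is homologous to \<open>c\<close>, has
  vanishing faces \<open>\<partial>\<^sub>i\<close> for \<open>i \<le> k\<close>, and its norm is at most twice that of \<open>c\<close>. After \<open>n\<close> such steps all
  faces vanish, at the cost of a factor \<open>2\<^sup>n\<close>.
\<close>

section \<open>Push-forward of finitely supported functions\<close>

abbreviation smul :: "real \<Rightarrow> ('a \<Rightarrow>\<^sub>0 real) \<Rightarrow> ('a \<Rightarrow>\<^sub>0 real)" where
  "smul t \<equiv> Poly_Mapping.map ((*) t)"

lemma lookup_smul: "Poly_Mapping.lookup (smul t c) x = t * Poly_Mapping.lookup c x"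
  by (simp add: Poly_Mapping.map.rep_eq when_def)

lemma smul_add: "smul t (a + b) = smul t a + smul t b"
  by (rule poly_mapping_eqI) (simp add: lookup_smul lookup_add algebra_simps)

lemma smul_smul: "smul s (smul t a) = smul (s * t) a"
  by (rule poly_mapping_eqI) (simp add: lookup_smul)

lemma smul_minus: "smul (- t) a = - smul t a"
  by (rule poly_mapping_eqI) (simp add: lookup_smul)

lemma smul_diff: "smul t (a - b) = smul t a - smul t b"
  by (rule poly_mapping_eqI) (simp add: lookup_smul lookup_minus algebra_simps)

lemma smul_0 [simp]: "smul t 0 = 0" "smul 0 a = 0" and smul_1 [simp]: "smul 1 a = a"
  by (auto intro!: poly_mapping_eqI simp: lookup_smul)

lemma smul_sum: "smul t (sum f I) = (\<Sum>i\<in>I. smul t (f i))"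
  by (induction I rule: infinite_finite_induct) (auto simp: smul_add)

lemma smul_single: "smul t (Poly_Mapping.single x a) = Poly_Mapping.single x (t * a)"
  by (rule poly_mapping_eqI) (simp add: lookup_smul lookup_single when_def)

lemma keys_smul: "Poly_Mapping.keys (smul t c) \<subseteq> Poly_Mapping.keys c"
  by (auto simp: in_keys_iff lookup_smul)

text \<open>Unpointed functoriality of finitely supported functions: coefficients are summed over
  the fibres of \<open>h\<close>. Faces and degeneracies of chains are instances, so linearity,
  composition and norm bounds are proved once here.\<close>

definition push :: "('a \<Rightarrow> 'b) \<Rightarrow> ('a \<Rightarrow>\<^sub>0 real) \<Rightarrow> ('b \<Rightarrow>\<^sub>0 real)" where
  "push h c = (\<Sum>x\<in>Poly_Mapping.keys c. Poly_Mapping.single (h x) (Poly_Mapping.lookup c x))"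

text \<open>Cancellation can shrink the support of a sum or a multiple. Summing over a fixed larger
  set makes linearity termwise.\<close>

lemma push_superset:
  assumes "finite A" "Poly_Mapping.keys c \<subseteq> A"
  shows "push h c = (\<Sum>x\<in>A. Poly_Mapping.single (h x) (Poly_Mapping.lookup c x))"
  unfolding push_def using assms
  by (intro sum.mono_neutral_left) (auto simp: in_keys_iff)

lemma push_0 [simp]: "push h 0 = 0"
  by (simp add: push_def)

lemma push_add: "push h (a + b) = push h a + push h b"
proof -
  let ?A = "Poly_Mapping.keys a \<union> Poly_Mapping.keys b"
  have "Poly_Mapping.keys (a + b) \<subseteq> ?A" by (rule keys_add)
  then show ?thesis
    by (simp add: push_superset[of ?A] lookup_add single_add sum.distrib)
qed

lemma push_smul: "push h (smul t a) = smul t (push h a)"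
  using push_superset[OF finite_keys keys_smul[of t a], of h]
  by (simp add: push_def[of h a] smul_sum smul_single lookup_smul)

lemma push_minus: "push h (- a) = - push h a"
  using push_smul[of h "-1" a] by (simp add: smul_minus)

lemma push_diff: "push h (a - b) = push h a - push h b"
  using push_add[of h a "- b"] by (simp add: push_minus)

lemma push_sum: "push h (sum f I) = (\<Sum>i\<in>I. push h (f i))"
  by (induction I rule: infinite_finite_induct) (auto simp: push_add)

lemma push_single [simp]: "push h (Poly_Mapping.single x a) = Poly_Mapping.single (h x) a"
  by (cases "a = 0") (auto simp: push_def)

lemma push_push: "push g (push h c) = push (g \<circ> h) c"
  by (simp add: push_def[of h] push_sum) (simp add: push_def)

lemma push_cong: "(\<And>x. x \<in> Poly_Mapping.keys c \<Longrightarrow> g x = h x) \<Longrightarrow> push g c = push h c"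
  by (simp add: push_def)

lemma sum_single_lookup: "(\<Sum>x\<in>Poly_Mapping.keys c. Poly_Mapping.single x (Poly_Mapping.lookup c x)) = c"
  by (rule poly_mapping_eqI) (auto simp: lookup_sum lookup_single when_def in_keys_iff sum.delta')

lemma push_id: "push (\<lambda>x. x) c = c"
  by (simp add: push_def sum_single_lookup)

lemma keys_push: "Poly_Mapping.keys (push h c) \<subseteq> h ` Poly_Mapping.keys c"
proof
  fix y assume "y \<in> Poly_Mapping.keys (push h c)"
  then have "(\<Sum>x\<in>Poly_Mapping.keys c. Poly_Mapping.lookup (Poly_Mapping.single (h x) (Poly_Mapping.lookup c x)) y) \<noteq> 0"
    by (simp add: push_def in_keys_iff lookup_sum)
  then obtain x where "x \<in> Poly_Mapping.keys c" "h x = y"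
    by (metis (no_types, lifting) lookup_single_not_eq sum.neutral)
  then show "y \<in> h ` Poly_Mapping.keys c" by blast
qed

section \<open>The l1-norm of finitely supported functions\<close>

lemma l1norm_superset:
  assumes "finite A" "Poly_Mapping.keys c \<subseteq> A"
  shows "l1norm c = (\<Sum>x\<in>A. \<bar>Poly_Mapping.lookup c x\<bar>)"
  unfolding l1norm_def using assms
  by (intro sum.mono_neutral_left) (auto simp: in_keys_iff)

lemma l1norm_nonneg: "0 \<le> l1norm c"
  by (simp add: l1norm_def sum_nonneg)

lemma l1norm_0 [simp]: "l1norm 0 = 0"
  by (simp add: l1norm_def)

lemma l1norm_add: "l1norm (a + b) \<le> l1norm a + l1norm b"
proof -
  let ?A = "Poly_Mapping.keys a \<union> Poly_Mapping.keys b"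
  have "Poly_Mapping.keys (a + b) \<subseteq> ?A" by (rule keys_add)
  then show ?thesis
    by (simp add: l1norm_superset[of ?A] lookup_add sum.distrib[symmetric] sum_mono)
qed

lemma l1norm_smul: "l1norm (smul t a) = \<bar>t\<bar> * l1norm a"
  using l1norm_superset[OF finite_keys keys_smul[of t a]]
  by (simp add: l1norm_def[of a] lookup_smul abs_mult sum_distrib_left)

lemma l1norm_diff: "l1norm (a - b) \<le> l1norm a + l1norm b"
  using l1norm_add[of a "smul (-1) b"] l1norm_smul[of "-1" b] by (simp add: smul_minus)

lemma l1norm_sum: "l1norm (sum f I) \<le> (\<Sum>i\<in>I. l1norm (f i))"
proof (induction I rule: infinite_finite_induct)
  case (insert i I)
  then show ?case using l1norm_add[of "f i" "sum f I"] by simp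
qed auto

lemma l1norm_single [simp]: "l1norm (Poly_Mapping.single x a) = \<bar>a\<bar>"
  by (cases "a = 0") (auto simp: l1norm_def)

text \<open>Merging fibres can only cancel mass, by the triangle inequality. Hence neither faces nor
  degeneracies increase the norm.\<close>

lemma l1norm_push: "l1norm (push h c) \<le> l1norm c"
  using l1norm_sum[of "\<lambda>x. Poly_Mapping.single (h x) (Poly_Mapping.lookup c x)" "Poly_Mapping.keys c"]
  by (simp add: push_def[symmetric] l1norm_def[of c, symmetric])


section \<open>Simplicial operators on singular simplices\<close>

text \<open>The action of \<open>sing_plus\<close> away from the base point. The restriction keeps
  the result extensional, as \<open>singular_simplex\<close> demands.\<close>

definition sact :: "nat \<Rightarrow> (nat \<Rightarrow> nat) \<Rightarrow> ((nat \<Rightarrow> real) \<Rightarrow> 'a) \<Rightarrow> ((nat \<Rightarrow> real) \<Rightarrow> 'a)" where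
  "sact p \<theta> \<sigma> = restrict (\<sigma> \<circ> simplex_map p \<theta>) (standard_simplex p)"

lemma simplex_map_simplex:
  assumes "\<theta> ` {..p} \<subseteq> {..q}" "x \<in> standard_simplex p"
  shows "simplex_map p \<theta> x \<in> standard_simplex q"
proof -
  have x: "\<And>i. 0 \<le> x i" "(\<Sum>i\<le>p. x i) = 1"
    using assms(2) by (auto simp: standard_simplex_def)
  have "simplex_map p \<theta> x i \<le> 1" for i
    unfolding simplex_map_def x(2)[symmetric] by (intro sum_mono2) (auto simp: x)
  moreover have "simplex_map p \<theta> x i = 0" if "i > q" for i
  proof -
    have "{a\<in>{..p}. \<theta> a = i} = {}" using assms(1) that by force
    then show ?thesis by (simp only: simplex_map_def sum.empty)
  qed
  moreover have "(\<Sum>i\<le>q. simplex_map p \<theta> x i) = 1"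
    unfolding simplex_map_def using sum_fibre[OF _ _ assms(1), of x] x(2) by simp
  ultimately show ?thesis by (auto simp: standard_simplex_def simplex_map_def x intro: sum_nonneg)
qed

lemma continuous_map_simplex_map:
  assumes "\<theta> ` {..p} \<subseteq> {..q}"
  shows "continuous_map (subtopology (powertop_real UNIV) (standard_simplex p))
           (subtopology (powertop_real UNIV) (standard_simplex q)) (simplex_map p \<theta>)"
proof -
  have "continuous_map (powertop_real UNIV) euclideanreal (\<lambda>x. simplex_map p \<theta> x i)" for i
    unfolding simplex_map_def
    by (intro continuous_map_sum continuous_map_product_projection) auto
  then show ?thesis
    using simplex_map_simplex[OF assms]
    by (auto simp: continuous_map_in_subtopology continuous_map_componentwise
        continuous_map_from_subtopology)
qed

lemma singular_simplex_sact:
  assumes "\<theta> ` {..p} \<subseteq> {..q}" "singular_simplex q X \<sigma>"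
  shows "singular_simplex p X (sact p \<theta> \<sigma>)"
  using assms(2) continuous_map_compose[OF continuous_map_simplex_map[OF assms(1)]]
  by (auto simp: singular_simplex_def sact_def)

text \<open>Grouping coordinates along \<open>\<theta>\<close> and then along \<open>\<eta>\<close>
  is grouping along the composite. Simplicial identities thereby reduce to equations between maps of
  finite ordinals.\<close>

lemma sact_sact:
  assumes "\<theta> ` {..p} \<subseteq> {..q}"
  shows "sact p \<theta> (sact q \<eta> \<sigma>) = sact p (\<eta> \<circ> \<theta>) \<sigma>"
proof -
  have "simplex_map q \<eta> (simplex_map p \<theta> x) = simplex_map p (\<eta> \<circ> \<theta>) x" for x
  proof
    fix j
    let ?J = "{a\<in>{..q}. \<eta> a = j}" and ?I = "{i\<in>{..p}. \<eta> (\<theta> i) = j}"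
    have "(\<Sum>a\<in>?J. \<Sum>i\<in>{i\<in>{..p}. \<theta> i = a}. x i) = (\<Sum>a\<in>?J. \<Sum>i\<in>{i\<in>?I. \<theta> i = a}. x i)"
      by (intro sum.cong) auto
    also have "\<dots> = (\<Sum>i\<in>?I. x i)"
      using assms by (intro sum_fibre) auto
    finally show "simplex_map q \<eta> (simplex_map p \<theta> x) j = simplex_map p (\<eta> \<circ> \<theta>) x j"
      by (simp add: simplex_map_def)
  qed
  then show ?thesis
    using simplex_map_simplex[OF assms] by (auto simp: sact_def)
qed

lemma sact_cong: "(\<And>i. i \<le> p \<Longrightarrow> \<theta> i = \<eta> i) \<Longrightarrow> sact p \<theta> \<sigma> = sact p \<eta> \<sigma>"
proof -
  assume "\<And>i. i \<le> p \<Longrightarrow> \<theta> i = \<eta> i"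
  then have "{i\<in>{..p}. \<theta> i = j} = {i\<in>{..p}. \<eta> i = j}" for j by auto
  then show ?thesis by (simp only: sact_def simplex_map_def comp_def)
qed

lemma sact_id:
  assumes "singular_simplex p X \<sigma>"
  shows "sact p (\<lambda>i. i) \<sigma> = \<sigma>"
proof
  fix x
  have "simplex_map p (\<lambda>i. i) x = x" if "x \<in> standard_simplex p"
  proof
    fix j
    have "{i\<in>{..p}. i = j} = (if j \<le> p then {j} else {})" by auto
    then show "simplex_map p (\<lambda>i. i) x j = x j"
      using that by (simp add: simplex_map_def standard_simplex_def)
  qed
  then show "sact p (\<lambda>i. i) \<sigma> x = \<sigma> x"
    using assms by (auto simp: sact_def singular_simplex_def extensional_def)
qed

lemma singular_face_sact:
  assumes "j \<le> Suc q"
  shows "singular_face (Suc q) j \<sigma> = sact q (coface j) \<sigma>"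
  \<comment> \<open>The face operators of \<open>sing_plus X\<close> do not depend on
    \<open>X\<close>, so an arbitrary topology may be inserted.\<close>
  using face_sing_plus[OF assms, of undefined \<sigma>] by (simp add: face_def sing_plus_def sact_def)

text \<open>The codegeneracy that takes the value \<open>k\<close> twice, at \<open>k\<close> and
  \<open>Suc k\<close>.\<close>

definition codegen :: "nat \<Rightarrow> nat \<Rightarrow> nat" where
  "codegen k i = (if i \<le> k then i else i - 1)"


section \<open>Normalisation of singular cycles\<close>

abbreviation rface :: "nat \<Rightarrow> nat \<Rightarrow> 'a rchain \<Rightarrow> 'a rchain" where
  "rface q j \<equiv> push (sact q (coface j))"

abbreviation rdegen :: "nat \<Rightarrow> nat \<Rightarrow> 'a rchain \<Rightarrow> 'a rchain" where
  "rdegen q k \<equiv> push (sact (Suc q) (codegen k))"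

section \<open>The boundary operator and the simplicial identities on chains\<close>

lemma rboundary_Suc:
  "rboundary (Suc q) c = (\<Sum>j\<le>Suc q. smul ((-1) ^ j) (rface q j c))"
proof -
  have "rboundary (Suc q) c = (\<Sum>\<sigma>\<in>Poly_Mapping.keys c. \<Sum>j\<le>Suc q.
      smul ((-1) ^ j) (Poly_Mapping.single (sact q (coface j) \<sigma>) (Poly_Mapping.lookup c \<sigma>)))"
    unfolding rboundary_def smul_single
    by (auto intro!: sum.cong simp: singular_face_sact simp del: sum.atMost_Suc)
  also have "\<dots> = (\<Sum>j\<le>Suc q. smul ((-1) ^ j) (rface q j c))"
    by (subst sum.swap) (simp only: push_def smul_sum)
  finally show ?thesis .
qed

lemma rboundary_add: "rboundary n (a + b) = rboundary n a + rboundary n b"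
  by (cases n) (simp_all add: rboundary_Suc rboundary_def[of 0] push_add smul_add sum.distrib del: sum.atMost_Suc)

lemma rboundary_smul: "rboundary n (smul t a) = smul t (rboundary n a)"
  by (cases n) (simp_all add: rboundary_Suc rboundary_def[of 0] push_smul smul_smul smul_sum mult.commute del: sum.atMost_Suc)

lemma rboundary_diff: "rboundary n (a - b) = rboundary n a - rboundary n b"
  using rboundary_add[of n a "smul (-1) b"] rboundary_smul[of n "-1" b] by (simp add: smul_minus)

lemma rboundary_zero [simp]: "rboundary n 0 = 0"
  using rboundary_smul[of n 0 0] by simp

lemma rchains_zero [simp]: "0 \<in> rchains n X"
  by (simp add: rchains_def)

lemma rchains_add: "a \<in> rchains n X \<Longrightarrow> b \<in> rchains n X \<Longrightarrow> a + b \<in> rchains n X"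
  using keys_add[of a b] by (auto simp: rchains_def)

lemma rchains_smul: "a \<in> rchains n X \<Longrightarrow> smul t a \<in> rchains n X"
  using keys_smul[of t a] by (auto simp: rchains_def)

lemma rchains_diff: "a \<in> rchains n X \<Longrightarrow> b \<in> rchains n X \<Longrightarrow> a - b \<in> rchains n X"
  using rchains_add[of a n X "smul (-1) b"] rchains_smul[of b n X "-1"] by (simp add: smul_minus)

lemma rchains_push_sact:
  assumes "\<theta> ` {..p} \<subseteq> {..q}" "c \<in> rchains q X"
  shows "push (sact p \<theta>) c \<in> rchains p X"
  using assms(2) keys_push[of "sact p \<theta>" c] singular_simplex_sact[OF assms(1)]
  by (fastforce simp: rchains_def)

lemma coface_image: "coface j ` {..q} \<subseteq> {..Suc q}"
  by (auto simp: coface_def)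

lemma codegen_image: "k \<le> q \<Longrightarrow> codegen k ` {..Suc q} \<subseteq> {..q}"
  by (auto simp: codegen_def)

lemmas rchains_rface = rchains_push_sact[OF coface_image]
lemmas rchains_rdegen = rchains_push_sact[OF codegen_image]

lemma push_sact_sact:
  assumes "\<theta> ` {..p} \<subseteq> {..q}"
  shows "push (sact p \<theta>) (push (sact q \<eta>) c) = push (sact p (\<eta> \<circ> \<theta>)) c"
  by (simp add: push_push comp_def sact_sact[OF assms])

lemma push_sact_cong: "(\<And>i. i \<le> p \<Longrightarrow> \<theta> i = \<eta> i) \<Longrightarrow> push (sact p \<theta>) c = push (sact p \<eta>) c"
  by (intro push_cong sact_cong)

lemma push_sact_id:
  assumes "c \<in> rchains p X" "\<And>i. i \<le> p \<Longrightarrow> \<theta> i = i"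
  shows "push (sact p \<theta>) c = c"
proof -
  have "push (sact p \<theta>) c = push (\<lambda>\<sigma>. \<sigma>) c"
  proof (rule push_cong)
    fix \<sigma> assume "\<sigma> \<in> Poly_Mapping.keys c"
    then show "sact p \<theta> \<sigma> = \<sigma>"
      using assms sact_cong[of p \<theta> "\<lambda>i. i" \<sigma>] sact_id[of p X \<sigma>] by (auto simp: rchains_def)
  qed
  then show ?thesis by (simp add: push_id)
qed

lemma rface_rface:
  assumes "i < j"
  shows "rface q i (rface (Suc q) j c) = rface q (j - 1) (rface (Suc q) i c)"
  using assms unfolding push_sact_sact[OF coface_image]
  by (intro push_sact_cong) (auto simp: coface_def)

lemma rface_rdegen_less:
  assumes "i < k" "k \<le> Suc q"
  shows "rface (Suc q) i (rdegen (Suc q) k c) = rdegen q (k - 1) (rface q i c)"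
proof -
  have "k - 1 \<le> q" using assms by simp
  show ?thesis
    unfolding push_sact_sact[OF coface_image] push_sact_sact[OF codegen_image[OF \<open>k - 1 \<le> q\<close>]]
    using assms by (intro push_sact_cong) (auto simp: coface_def codegen_def)
qed

lemma rface_rdegen_greater:
  assumes "Suc k < i" "k \<le> q"
  shows "rface (Suc q) i (rdegen (Suc q) k c) = rdegen q k (rface q (i - 1) c)"
  unfolding push_sact_sact[OF coface_image] push_sact_sact[OF codegen_image[OF \<open>k \<le> q\<close>]]
  using assms by (intro push_sact_cong) (auto simp: coface_def codegen_def)

text \<open>Both composites of ordinal maps are the identity. Membership in \<open>rchains\<close>
  enters because the identity operator restricts a simplex and so fixes only extensional
  ones.\<close>

lemma rface_rdegen_eq:
  assumes "i = k \<or> i = Suc k" "c \<in> rchains q X"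
  shows "rface q i (rdegen q k c) = c"
  unfolding push_sact_sact[OF coface_image]
  using assms by (intro push_sact_id[OF assms(2)]) (auto simp: coface_def codegen_def)

lemma rboundary_rboundary: "rboundary (Suc q) (rboundary (Suc (Suc q)) c) = 0"
proof -
  let ?t = "\<lambda>(i, j). smul ((-1) ^ (i + j)) (rface q i (rface (Suc q) j c))"
  let ?A = "{..Suc q} \<times> {..Suc (Suc q)}"
  let ?L = "{(i, j). i < j \<and> j \<le> Suc (Suc q)}" and ?U = "{(i, j). j \<le> i \<and> i \<le> Suc q}"
  have fin: "finite ?A" by simp
  have A: "?A = ?L \<union> ?U" by auto
  have fins: "finite ?L" "finite ?U" using fin unfolding A by auto
  have sign: "- ((-1) ^ (a + b - Suc 0)) = ((-1) ^ (a + b) :: real)" if "a < b" for a b :: nat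
    using that by (cases b) auto
  have "rboundary (Suc q) (rboundary (Suc (Suc q)) c) = sum ?t ?A"
    by (simp only: rboundary_Suc push_sum smul_sum push_smul smul_smul power_add[symmetric]
        sum.cartesian_product)
  also have "\<dots> = sum ?t ?L + sum ?t ?U"
    unfolding A by (rule sum.union_disjoint[OF fins]) auto
  \<comment> \<open>The simplicial identity matches \<open>(i, j)\<close> with \<open>i < j\<close>
    to \<open>(j - 1, i)\<close>; the total index drops by one, so the sign flips.\<close>
  also have "sum ?t ?L = (\<Sum>x\<in>?U. - ?t x)"
    by (rule sum.reindex_bij_witness[where i = "\<lambda>(i, j). (j, Suc i)" and j = "\<lambda>(i, j). (j - 1, i)"])
      (auto simp: rface_rface smul_minus[symmetric] add.commute sign)
  finally show ?thesis by (simp add: sum_negf)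
qed

section \<open>Making faces vanish one at a time\<close>

text \<open>The invariant of the normalisation, in degree \<open>q + 1\<close>. For
  \<open>k = 0\<close> these are all cycles; for \<open>k = q + 1\<close> only the last face is
  left, and the cycle condition kills it.\<close>

definition partially_normalised :: "nat \<Rightarrow> 'a topology \<Rightarrow> nat \<Rightarrow> 'a rchain set" where
  "partially_normalised q X k = {c \<in> rcycles (Suc q) X. \<forall>i<k. rface q i c = 0}"

text \<open>Faces below \<open>k\<close> vanish with those of \<open>c\<close>, and the faces
  \<open>k\<close> and \<open>k + 1\<close> of the degeneracy cancel. The remaining ones give minus
  the degeneracy of the tail of the boundary of \<open>c\<close>, which the cycle condition
  expresses by the single face \<open>k\<close>.\<close>

lemma rboundary_rdegen:
  assumes c: "c \<in> partially_normalised q X k" and k: "k \<le> q"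
  shows "rboundary (Suc (Suc q)) (rdegen (Suc q) k c) = smul ((-1) ^ k) (rdegen q k (rface q k c))"
proof -
  let ?s = "\<lambda>i. smul ((-1) ^ i) :: 'a rchain \<Rightarrow> _" and ?D = "rdegen (Suc q) k c"
  have ch: "c \<in> rchains (Suc q) X" and bd: "rboundary (Suc q) c = 0"
    and z: "\<And>i. i < k \<Longrightarrow> rface q i c = 0"
    using c by (auto simp: partially_normalised_def rcycles_def)
  have split: "{..Suc (Suc q)} = {..<k} \<union> {k, Suc k} \<union> {Suc (Suc k)..Suc (Suc q)}"
    and split': "{..Suc q} = {..<k} \<union> {k} \<union> {Suc k..Suc q}"
    using k by auto
  have "0 = (\<Sum>i\<le>Suc q. ?s i (rface q i c))" using bd by (simp add: rboundary_Suc)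
  also have "\<dots> = ?s k (rface q k c) + (\<Sum>i=Suc k..Suc q. ?s i (rface q i c))"
    unfolding split' by (subst sum.union_disjoint) (auto simp: z)
  finally have rest: "(\<Sum>i=Suc k..Suc q. ?s i (rface q i c)) = - ?s k (rface q k c)"
    by (simp add: eq_neg_iff_add_eq_0 add.commute)
  have "rboundary (Suc (Suc q)) ?D = (\<Sum>i<k. ?s i (rface (Suc q) i ?D))
      + (\<Sum>i\<in>{k, Suc k}. ?s i (rface (Suc q) i ?D))
      + (\<Sum>i=Suc (Suc k)..Suc (Suc q). ?s i (rface (Suc q) i ?D))"
    unfolding rboundary_Suc split by (subst sum.union_disjoint, auto)+
  also have "(\<Sum>i<k. ?s i (rface (Suc q) i ?D)) = 0"
    using k by (intro sum.neutral) (auto simp: rface_rdegen_less z)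
  also have "(\<Sum>i\<in>{k, Suc k}. ?s i (rface (Suc q) i ?D)) = 0"
    by (simp add: rface_rdegen_eq[OF _ ch] smul_minus)
  \<comment> \<open>Commuting such a face past the degeneracy lowers its index by one; the shift
    matches this and reverses every sign.\<close>
  also have "(\<Sum>i=Suc (Suc k)..Suc (Suc q). ?s i (rface (Suc q) i ?D))
      = (\<Sum>i=Suc k..Suc q. ?s (Suc i) (rface (Suc q) (Suc i) ?D))"
    by (rule sum.shift_bounds_cl_Suc_ivl)
  also have "\<dots> = (\<Sum>i=Suc k..Suc q. - rdegen q k (?s i (rface q i c)))"
    using k by (intro sum.cong) (auto simp: rface_rdegen_greater smul_minus push_smul)
  also have "\<dots> = - rdegen q k (\<Sum>i=Suc k..Suc q. ?s i (rface q i c))"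
    by (simp only: sum_negf push_sum)
  also have "\<dots> = smul ((-1) ^ k) (rdegen q k (rface q k c))"
    unfolding rest by (simp only: push_minus push_smul minus_minus)
  finally show ?thesis by simp
qed

lemma rboundaries_smul: "b \<in> rboundaries n X \<Longrightarrow> smul t b \<in> rboundaries n X"
  unfolding rboundaries_def by (auto simp: rboundary_smul[symmetric] intro: rchains_smul)

lemma rboundaries_add: "a \<in> rboundaries n X \<Longrightarrow> b \<in> rboundaries n X \<Longrightarrow> a + b \<in> rboundaries n X"
  unfolding rboundaries_def by (auto simp: rboundary_add[symmetric] intro: rchains_add)

lemma rboundaries_zero [simp]: "0 \<in> rboundaries n X"
  unfolding rboundaries_def by (metis image_eqI rboundary_zero rchains_zero)

lemma rboundaries_diff: "a \<in> rboundaries n X \<Longrightarrow> b \<in> rboundaries n X \<Longrightarrow> a - b \<in> rboundaries n X"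
  using rboundaries_add[of a n X "smul (-1) b"] rboundaries_smul[of b n X "-1"]
  by (simp add: smul_minus)

lemma normalise_step:
  assumes c: "c \<in> partially_normalised q X k" and k: "k \<le> q"
  shows "\<exists>c'\<in>partially_normalised q X (Suc k). c' - c \<in> rboundaries (Suc q) X \<and> l1norm c' \<le> 2 * l1norm c"
proof -
  define d where "d = rdegen q k (rface q k c)"
  have ch: "c \<in> rchains (Suc q) X" and bd: "rboundary (Suc q) c = 0"
    and z: "\<And>i. i < k \<Longrightarrow> rface q i c = 0"
    using c by (auto simp: partially_normalised_def rcycles_def)
  have fk: "rface q k c \<in> rchains q X" by (rule rchains_rface[OF ch])
  have dch: "d \<in> rchains (Suc q) X" unfolding d_def by (rule rchains_rdegen[OF k fk])
  have "smul ((-1) ^ k) d \<in> rboundaries (Suc q) X"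
    unfolding d_def rboundary_rdegen[OF c k, symmetric] rboundaries_def
    using rchains_rdegen[OF _ ch] k by auto
  \<comment> \<open>The sign squares to 1, so multiplying by it once more removes it.\<close>
  from rboundaries_smul[OF this, of "(-1) ^ k"] have db: "d \<in> rboundaries (Suc q) X"
    by (simp add: smul_smul)
  \<comment> \<open>Subtracting \<open>d\<close> must cancel face \<open>k\<close> without
    disturbing the faces that already vanish.\<close>
  have dfaces: "rface q i d = (if i = k then rface q k c else 0)" if "i \<le> k" for i
  proof (cases "i = k")
    case True
    then show ?thesis by (simp add: d_def rface_rdegen_eq[OF _ fk])
  next
    case False
    then have "i < k" using that by simp
    then obtain q' where q: "q = Suc q'" using k by (cases q) auto
    have "rface q i d = rdegen q' (k - 1) (rface q' i (rface q k c))"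
      using \<open>i < k\<close> k by (simp add: d_def q rface_rdegen_less)
    also have "rface q' i (rface q k c) = rface q' (k - 1) (rface q i c)"
      unfolding q by (rule rface_rface[OF \<open>i < k\<close>])
    finally show ?thesis using z \<open>i < k\<close> by simp
  qed
  \<comment> \<open>Up to sign \<open>d\<close> is itself a boundary, hence a cycle.\<close>
  have "rboundary (Suc q) d = 0"
  proof -
    have "smul ((-1) ^ k) (rboundary (Suc q) d) = 0"
      by (simp only: rboundary_smul[symmetric] d_def rboundary_rdegen[OF c k, symmetric] rboundary_rboundary)
    then have "smul ((-1) ^ k) (smul ((-1) ^ k) (rboundary (Suc q) d)) = 0"
      by simp
    then show ?thesis by (simp add: smul_smul)
  qed
  then have "c - d \<in> partially_normalised q X (Suc k)"
    using ch dch bd dfaces z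
    by (auto simp: partially_normalised_def rcycles_def rchains_diff rboundary_diff push_diff less_Suc_eq)
  moreover have "(c - d) - c \<in> rboundaries (Suc q) X"
    using rboundaries_smul[OF db, of "-1"] by (simp add: smul_minus)
  moreover have "l1norm (c - d) \<le> 2 * l1norm c"
  proof -
    have "l1norm d \<le> l1norm c"
      unfolding d_def using l1norm_push order_trans by blast
    then show ?thesis using l1norm_diff[of c d] by simp
  qed
  ultimately show ?thesis by blast
qed

section \<open>Homology classes and their normalised representatives\<close>

lemma hclass_eqI:
  assumes "a - b \<in> rboundaries n X"
  shows "hclass n X a = hclass n X b"
proof -
  have "c - b \<in> rboundaries n X \<longleftrightarrow> c - a \<in> rboundaries n X" for c
    using rboundaries_add[OF _ assms, of "c - a"] rboundaries_diff[OF _ assms, of "c - b"] by auto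
  then show ?thesis by (simp add: hclass_def)
qed

text \<open>The cycles of the Moore complex of the simplicial vector space of chains, shaped like
  \<open>Zcomb\<close>, with no condition in degree 0.\<close>

definition normalised_cycles :: "nat \<Rightarrow> 'a topology \<Rightarrow> 'a rchain set" where
  "normalised_cycles n X = {c \<in> rchains n X. n = 0 \<or> (\<forall>j\<le>n. rface (n - 1) j c = 0)}"

lemma normalised_cycles_subset: "normalised_cycles n X \<subseteq> rcycles n X"
  by (cases n) (auto simp: normalised_cycles_def rcycles_def rboundary_Suc rboundary_def[of 0])

text \<open>Of the \<open>n + 1\<close> faces, the first \<open>n\<close> take one step each, with a
  factor 2 every time. The last face then vanishes because the chain is a cycle, so the factor is
  \<open>2 ^ n\<close>.\<close>

lemma normalised_representative:
  assumes "c \<in> rcycles n X"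
  shows "\<exists>c'\<in>normalised_cycles n X. hclass n X c' = hclass n X c \<and> l1norm c' \<le> 2 ^ n * l1norm c"
proof (cases n)
  case 0
  then show ?thesis using assms by (auto simp: normalised_cycles_def rcycles_def)
next
  case (Suc q)
  have "\<exists>c'\<in>partially_normalised q X k. hclass n X c' = hclass n X c \<and> l1norm c' \<le> 2 ^ k * l1norm c"
    if "k \<le> Suc q" for k
    using that
  proof (induction k)
    case 0
    then show ?case using assms by (auto simp: partially_normalised_def Suc)
  next
    case (Suc k)
    then obtain c1 where c1: "c1 \<in> partially_normalised q X k" "hclass n X c1 = hclass n X c"
      "l1norm c1 \<le> 2 ^ k * l1norm c" by auto
    obtain c2 where c2: "c2 \<in> partially_normalised q X (Suc k)" "c2 - c1 \<in> rboundaries n X"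
      "l1norm c2 \<le> 2 * l1norm c1"
      using normalise_step[OF c1(1)] Suc.prems \<open>n = Suc q\<close> by auto
    show ?case using c1 c2 hclass_eqI[OF c2(2)] by (intro bexI[OF _ c2(1)]) auto
  qed
  from this[of n] Suc obtain c' where c': "c' \<in> partially_normalised q X n"
    "hclass n X c' = hclass n X c" "l1norm c' \<le> 2 ^ n * l1norm c" by auto
  then have ch: "c' \<in> rchains n X" and z: "\<And>i. i \<le> q \<Longrightarrow> rface q i c' = 0"
    and bd: "rboundary (Suc q) c' = 0"
    by (auto simp: partially_normalised_def rcycles_def Suc)
  have "smul ((-1) ^ Suc q) (rface q (Suc q) c') = 0"
    using bd z by (simp add: rboundary_Suc)
  then have "rface q (Suc q) c' = 0"
    by (metis smul_smul smul_1 smul_0(1) left_minus_one_mult_self)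
  then have "c' \<in> normalised_cycles n X"
    using ch z by (auto simp: normalised_cycles_def Suc le_Suc_eq)
  then show ?thesis using c' by blast
qed


section \<open>Elements of the extended module as chains\<close>

definition cells :: "nat \<Rightarrow> 'a topology \<Rightarrow> (((nat \<Rightarrow> real) \<Rightarrow> 'a) option \<times> nat) set" where
  "cells q X = insert (None, 0) ((\<lambda>\<sigma>. (Some \<sigma>, Suc 0)) ` {\<sigma>. singular_simplex q X \<sigma>})"

lemma cells_simps [simp]:
  "(None, 0) \<in> cells q X" "(Some \<sigma>, Suc 0) \<in> cells q X \<longleftrightarrow> singular_simplex q X \<sigma>"
  by (auto simp: cells_def)

lemma cells_cases:
  assumes "y \<in> cells q X"
  obtains "y = (None, 0)" | \<sigma> where "y = (Some \<sigma>, Suc 0)" "singular_simplex q X \<sigma>"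
  using assms by (auto simp: cells_def)

lemma simplices_smash_sing_plus: "simplices (smash (sing_plus X) (Suc 0)) q = cells q X"
proof -
  have "smash_norm None ` (insert None (Some ` {\<sigma>. singular_simplex q X \<sigma>}) \<times> {..Suc 0}) = cells q X"
  proof (intro equalityI subsetI)
    fix y assume "y \<in> cells q X"
    then show "y \<in> smash_norm None ` (insert None (Some ` {\<sigma>. singular_simplex q X \<sigma>}) \<times> {..Suc 0})"
    proof (cases rule: cells_cases)
      case 1
      then show ?thesis by (intro image_eqI[where x = "(None, 0)"]) (auto simp: smash_norm_def)
    next
      case (2 \<sigma>)
      then show ?thesis by (intro image_eqI[where x = "(Some \<sigma>, Suc 0)"]) (auto simp: smash_norm_def)
    qed
  qed (auto simp: smash_norm_def le_Suc_eq)
  then show ?thesis by (simp add: smash_def sing_plus_def)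
qed

lemma pt_smash_sing_plus: "pt (smash (sing_plus X) k) q = (None, 0)"
  by (simp add: smash_def sing_plus_def)

text \<open>Sending the base point to 0 lets indices whose point is the base point drop out of
  \<open>rep_chain\<close>.\<close>

definition cell_chain :: "('b option \<times> nat) \<Rightarrow> real \<Rightarrow> ('b \<Rightarrow>\<^sub>0 real)" where
  "cell_chain y t = (case fst y of None \<Rightarrow> 0 | Some \<sigma> \<Rightarrow> Poly_Mapping.single \<sigma> t)"

lemma cell_chain_simps [simp]:
  "cell_chain (None, i) t = 0" "cell_chain (Some \<sigma>, i) t = Poly_Mapping.single \<sigma> t"
  by (auto simp: cell_chain_def)

lemma cell_chain_sum: "cell_chain y (sum f I) = (\<Sum>i\<in>I. cell_chain y (f i))"
  by (induction I rule: infinite_finite_induct) (auto simp: cell_chain_def single_add split: option.splits)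

text \<open>The same sum as in \<open>chain_of\<close>, but also meaningful when \<open>f\<close> is
  not injective and meets the base point at positive indices.\<close>

definition rep_chain :: "nat \<times> (nat \<Rightarrow> 'b option \<times> nat) \<times> (nat \<Rightarrow> real) \<Rightarrow> ('b \<Rightarrow>\<^sub>0 real)" where
  "rep_chain = (\<lambda>(k, f, m). \<Sum>i=1..k. cell_chain (f i) (m i))"

text \<open>Representatives without injectivity of \<open>f\<close>: this is what
  \<open>sm_ext_map\<close> produces when it composes an enumeration with a simplicial
  operator.\<close>

definition pre_rep :: "real \<Rightarrow> nat \<Rightarrow> 'a topology \<Rightarrow>
    (nat \<times> (nat \<Rightarrow> ((nat \<Rightarrow> real) \<Rightarrow> 'a) option \<times> nat) \<times> (nat \<Rightarrow> real)) set" where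
  "pre_rep r q X = {(k, f, m). f 0 = (None, 0) \<and> f ` {..k} \<subseteq> cells q X \<and> m \<in> sm_ob (norm_HR r) k}"

text \<open>\<open>HR\<close> sums coefficients over the fibres of \<open>g\<close>, which only
  regroups the chain. Indices that \<open>g\<close> sends to 0 lie over the base point and
  contribute nothing.\<close>

lemma rep_chain_map:
  assumes g: "g \<in> gamma_hom k p" and u: "u 0 = (None, 0)" and f: "\<And>i. i \<le> k \<Longrightarrow> f i = u (g i)"
  shows "rep_chain (p, u, sm_map HR k p g m) = rep_chain (k, f, m)"
proof -
  let ?I = "{i\<in>{1..k}. g i \<in> {1..p}}"
  have "rep_chain (p, u, sm_map HR k p g m)
      = (\<Sum>j=1..p. \<Sum>i\<in>{i\<in>{1..k}. g i = j}. cell_chain (u j) (m i))"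
    by (auto simp: rep_chain_def HR_def cell_chain_sum intro!: sum.cong)
  also have "\<dots> = (\<Sum>j=1..p. \<Sum>i\<in>{i\<in>?I. g i = j}. cell_chain (f i) (m i))"
    by (intro sum.cong) (auto simp: f)
  also have "\<dots> = (\<Sum>i\<in>?I. cell_chain (f i) (m i))"
    by (rule sum.group) auto
  also have "\<dots> = (\<Sum>i=1..k. cell_chain (f i) (m i))"
  proof (rule sum.mono_neutral_left)
    show "\<forall>i\<in>{1..k} - ?I. cell_chain (f i) (m i) = 0"
    proof
      fix i assume i: "i \<in> {1..k} - ?I"
      moreover have "g i \<le> p" using g i by (auto simp: gamma_hom_def)
      ultimately have "g i = 0" by auto
      then show "cell_chain (f i) (m i) = 0" using i f[of i] u by simp
    qed
  qed auto
  finally show ?thesis by (simp add: rep_chain_def)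
qed

lemma lookup_rep_chain:
  assumes "f ` {..k} \<subseteq> cells q X"
  shows "Poly_Mapping.lookup (rep_chain (k, f, m)) \<sigma> = (\<Sum>i\<in>{i\<in>{1..k}. f i = (Some \<sigma>, Suc 0)}. m i)"
proof -
  have "Poly_Mapping.lookup (cell_chain (f i) (m i)) \<sigma> = (if f i = (Some \<sigma>, Suc 0) then m i else 0)"
    if "i \<in> {1..k}" for i
  proof -
    have "f i \<in> cells q X" using assms that by auto
    then show ?thesis unfolding cells_def by (auto simp: lookup_single when_def)
  qed
  then have "Poly_Mapping.lookup (rep_chain (k, f, m)) \<sigma> = (\<Sum>i=1..k. if f i = (Some \<sigma>, Suc 0) then m i else 0)"
    by (simp add: rep_chain_def lookup_sum)
  also have "\<dots> = (\<Sum>i\<in>{i\<in>{1..k}. f i = (Some \<sigma>, Suc 0)}. m i)"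
    by (rule sum.inter_filter[symmetric]) simp
  finally show ?thesis .
qed

section \<open>Colimit classes as chains of bounded norm\<close>

lemma sm_map_norm_HR: "sm_map (norm_HR r) = sm_map HR"
  by (simp add: norm_HR_def)

text \<open>Gluing preserves the chain by \<open>rep_chain_map\<close>. Conversely, both images lie
  in one finite pointed set, and there the coefficient vector can be read off from the
  chain.\<close>

lemma colim_glue_iff:
  assumes s: "s \<in> pre_rep r q X" and t: "t \<in> pre_rep r' q X"
  shows "colim_glue (norm_HR r'') (cells q X) (None, 0) s t \<longleftrightarrow> rep_chain s = rep_chain t"
proof -
  obtain k f m k' f' m' where st: "s = (k, f, m)" "t = (k', f', m')" by (metis prod_cases3)
  have f: "f 0 = (None, 0)" "f ` {..k} \<subseteq> cells q X" and f': "f' 0 = (None, 0)" "f' ` {..k'} \<subseteq> cells q X"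
    using s t by (auto simp: st pre_rep_def)
  show ?thesis
  proof
    assume "colim_glue (norm_HR r'') (cells q X) (None, 0) s t"
    then obtain p u g g' where u: "enumerates (cells q X) (None, 0) p u"
      and g: "g \<in> gamma_hom k p" "g' \<in> gamma_hom k' p"
      and fg: "\<forall>i\<le>k. f i = u (g i)" "\<forall>i\<le>k'. f' i = u (g' i)"
      and eq: "sm_map HR k p g m = sm_map HR k' p g' m'"
      by (auto simp: colim_glue_def st sm_map_norm_HR)
    have "u 0 = (None, 0)" using u by (simp add: enumerates_def)
    then show "rep_chain s = rep_chain t"
      using rep_chain_map[OF g(1), of u f m] rep_chain_map[OF g(2), of u f' m'] fg eq
      by (simp add: st)
  next
    assume eq: "rep_chain s = rep_chain t"
    \<comment> \<open>The joint image without the base point is enumerated from 1, leaving index 0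
      for the base point.\<close>
    define F where "F = f ` {..k} \<union> f' ` {..k'} - {(None, 0)}"
    have "finite F" by (simp add: F_def)
    then obtain h where h: "bij_betw h {1..card F} F"
      using ex_bij_betw_nat_finite_1 by blast
    define p where "p = card F"
    define u where "u = h(0 := (None, 0))"
    have FF: "f ` {..k} \<union> f' ` {..k'} \<subseteq> insert (None, 0) F" "(None, 0) \<notin> F" "F \<subseteq> cells q X"
      using f f' by (auto simp: F_def)
    have u0: "u 0 = (None, 0)" by (simp add: u_def)
    have split: "{..p} = insert 0 {1..p}" by auto
    have u1: "u i = h i" if "i \<in> {1..p}" for i using that by (simp add: u_def)
    have im: "u ` {1..p} = F"
      using bij_betw_imp_surj_on[OF h] u1 by (simp add: p_def)
    have "inj_on u {1..p}"
      using bij_betw_imp_inj_on[OF h] inj_on_cong[of "{1..p}" u h, OF u1] by (simp add: p_def)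
    then have inj: "inj_on u {..p}"
      unfolding split inj_on_insert using im u0 FF(2) by auto
    have im2: "u ` {..p} = insert (None, 0) F" unfolding split using im u0 by (simp del: One_nat_def)
    then have im': "f ` {..k} \<union> f' ` {..k'} \<subseteq> u ` {..p}" using FF(1) by simp
    have "(None, 0) \<in> cells q X" by (simp add: cells_def)
    then have u: "enumerates (cells q X) (None, 0) p u"
      unfolding enumerates_def im2 using u0 inj FF(3) by simp
    define g where "g = inv_into {..p} u \<circ> f"
    define g' where "g' = inv_into {..p} u \<circ> f'"
    have ug: "u (g i) = f i" "g i \<le> p" if "i \<le> k" for i
      using that im' f_inv_into_f[of "f i" u "{..p}"] inv_into_into[of "f i" u "{..p}"]
      by (auto simp: g_def)
    have ug': "u (g' i) = f' i" "g' i \<le> p" if "i \<le> k'" for i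
      using that im' f_inv_into_f[of "f' i" u "{..p}"] inv_into_into[of "f' i" u "{..p}"]
      by (auto simp: g'_def)
    have inv0: "inv_into {..p} u (None, 0) = 0"
      using inv_into_f_f[OF inj, of 0] u0 by simp
    have g: "g \<in> gamma_hom k p" "g' \<in> gamma_hom k' p"
      using ug(2) ug'(2) f(1) f'(1) inv0 by (auto simp: gamma_hom_def g_def g'_def)
    \<comment> \<open>For \<open>j \<ge> 1\<close> the point \<open>u j\<close> is a singular
      simplex, and both sides are the coefficient of the common chain there.\<close>
    have "sm_map HR k p g m j = sm_map HR k' p g' m' j" for j
    proof (cases "j \<in> {1..p}")
      case True
      then have "u j \<in> F" using im by blast
      then have "u j \<in> cells q X" "u j \<noteq> (None, 0)" using FF by auto
      then obtain \<sigma> where \<sigma>: "u j = (Some \<sigma>, Suc 0)" by (auto elim: cells_cases)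
      have eqv: "g i = j \<longleftrightarrow> f i = (Some \<sigma>, Suc 0)" if "i \<in> {1..k}" for i
        using that ug[of i] True \<sigma> inj_onD[OF inj, of "g i" j] by auto
      have eqv': "g' i = j \<longleftrightarrow> f' i = (Some \<sigma>, Suc 0)" if "i \<in> {1..k'}" for i
        using that ug'[of i] True \<sigma> inj_onD[OF inj, of "g' i" j] by auto
      have "{i\<in>{1..k}. g i = j} = {i\<in>{1..k}. f i = (Some \<sigma>, Suc 0)}"
        using eqv by blast
      moreover have "{i\<in>{1..k'}. g' i = j} = {i\<in>{1..k'}. f' i = (Some \<sigma>, Suc 0)}"
        using eqv' by blast
      ultimately show ?thesis
        using True eq lookup_rep_chain[OF f(2), of m \<sigma>] lookup_rep_chain[OF f'(2), of m' \<sigma>]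
        by (simp add: HR_def st)
    qed (auto simp: HR_def)
    then have "sm_map HR k p g m = sm_map HR k' p g' m'" by blast
    then show "colim_glue (norm_HR r'') (cells q X) (None, 0) s t"
      unfolding colim_glue_def st sm_map_norm_HR prod.case
      using u g ug(1) ug'(1) by (intro exI[of _ p] exI[of _ u] exI[of _ g] exI[of _ g']) simp
  qed
qed

text \<open>
  The element of \<open>\<parallel>HR\<parallel>\<^sub>r((sin X)\<^sub>q)\<close> that corresponds to the chain \<open>c\<close>; empty if \<open>c\<close> has norm at
  least \<open>r\<close>.
\<close>

definition chain_elt :: "real \<Rightarrow> nat \<Rightarrow> 'a topology \<Rightarrow> 'a rchain \<Rightarrow>
    (nat \<times> (nat \<Rightarrow> ((nat \<Rightarrow> real) \<Rightarrow> 'a) option \<times> nat) \<times> (nat \<Rightarrow> real)) set" where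
  "chain_elt r q X c = {t \<in> colim_rep (norm_HR r) (cells q X) (None, 0). rep_chain t = c}"

lemma colim_rep_pre_rep: "colim_rep (norm_HR r) (cells q X) (None, 0) \<subseteq> pre_rep r q X"
  by (auto simp: colim_rep_def pre_rep_def enumerates_def)

text \<open>Gluing is equality of chains, so classes are fibres of \<open>rep_chain\<close>, also
  for the non-injective representatives met in \<open>face_HRX\<close>.\<close>

lemma colim_class_eq:
  assumes "s \<in> pre_rep r q X"
  shows "colim_class (norm_HR r) (cells q X) (None, 0) s = chain_elt r q X (rep_chain s)"
proof -
  have "colim_glue (norm_HR r) (cells q X) (None, 0) s t \<longleftrightarrow> rep_chain t = rep_chain s"
    if "t \<in> colim_rep (norm_HR r) (cells q X) (None, 0)" for t
    using colim_glue_iff[OF assms subsetD[OF colim_rep_pre_rep that]] by (simp add: eq_commute)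
  then show ?thesis unfolding colim_class_def chain_elt_def by blast
qed

lemma rep_chain_bounds:
  assumes "s \<in> pre_rep r q X"
  shows "rep_chain s \<in> rchains q X" "l1norm (rep_chain s) < r"
proof -
  obtain k f m where s: "s = (k, f, m)" by (metis prod_cases3)
  have f: "f i \<in> cells q X" if "i \<in> {1..k}" for i using assms that by (auto simp: s pre_rep_def)
  have m: "(\<Sum>j=1..k. \<bar>m j\<bar>) < r" using assms by (auto simp: s pre_rep_def norm_HR_def)
  have "Poly_Mapping.keys (rep_chain s) \<subseteq> (\<Union>i\<in>{1..k}. Poly_Mapping.keys (cell_chain (f i) (m i)))"
    unfolding rep_chain_def s by (simp add: keys_sum)
  also have "\<dots> \<subseteq> {\<sigma>. singular_simplex q X \<sigma>}"
  proof (rule UN_least)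
    fix i assume "i \<in> {1..k}"
    from f[OF this] show "Poly_Mapping.keys (cell_chain (f i) (m i)) \<subseteq> {\<sigma>. singular_simplex q X \<sigma>}"
      by (cases rule: cells_cases) auto
  qed
  finally show "rep_chain s \<in> rchains q X" by (auto simp: rchains_def)
  have "l1norm (rep_chain s) \<le> (\<Sum>i=1..k. l1norm (cell_chain (f i) (m i)))"
    by (simp add: rep_chain_def s l1norm_sum)
  also have "\<dots> \<le> (\<Sum>i=1..k. \<bar>m i\<bar>)"
    by (intro sum_mono) (auto simp: cell_chain_def split: option.splits)
  finally show "l1norm (rep_chain s) < r" using m by simp
qed

text \<open>Enumerating the support of \<open>c\<close> without repetition gives a coefficient
  vector of exactly the norm of \<open>c\<close>.\<close>

lemma chain_elt_nonempty:
  assumes "c \<in> rchains q X" "l1norm c < r"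
  shows "chain_elt r q X c \<noteq> {}"
proof -
  let ?K = "Poly_Mapping.keys c"
  define k where "k = card ?K"
  obtain h where h: "bij_betw h {1..k} ?K"
    using ex_bij_betw_nat_finite_1[of ?K] by (auto simp: k_def)
  define f where "f i = (if i = 0 then (None, 0) else (Some (h i), 1 :: nat))" for i
  define m where "m i = (if i \<in> {1..k} then Poly_Mapping.lookup c (h i) else 0)" for i
  have split: "{..k} = insert 0 {1..k}" by auto
  have inj: "inj_on h {1..k}" using h by (simp add: bij_betw_def)
  have f1: "f i = (Some (h i), 1)" if "i \<in> {1..k}" for i using that by (simp add: f_def)
  have "inj_on f {1..k}"
    by (rule inj_onI) (use inj in \<open>simp add: f1 inj_on_eq_iff del: One_nat_def\<close>)
  moreover have "f 0 \<notin> f ` {1..k}" by (auto simp: f_def)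
  ultimately have "inj_on f {..k}" unfolding split by simp
  moreover have "f i \<in> cells q X" if "i \<le> k" for i
  proof (cases "i = 0")
    case False
    then have i: "i \<in> {1..k}" using that by simp
    then have "h i \<in> ?K" using bij_betwE[OF h] by blast
    then show ?thesis using assms(1) by (simp add: f1[OF i] cells_def rchains_def)
  qed (simp add: f_def cells_def)
  then have "f ` {..k} \<subseteq> cells q X" by auto
  ultimately have enum: "enumerates (cells q X) (None, 0) k f"
    by (simp add: enumerates_def f_def)
  have "(\<Sum>j=1..k. \<bar>m j\<bar>) = (\<Sum>j=1..k. \<bar>Poly_Mapping.lookup c (h j)\<bar>)"
    by (intro sum.cong) (auto simp: m_def)
  also have "\<dots> = l1norm c"
    unfolding l1norm_def by (rule sum.reindex_bij_betw[OF h])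
  finally have "m \<in> sm_ob (norm_HR r) k"
    using assms(2) by (auto simp: norm_HR_def HR_def m_def)
  moreover have "rep_chain (k, f, m) = c"
  proof -
    have "rep_chain (k, f, m) = (\<Sum>i=1..k. Poly_Mapping.single (h i) (Poly_Mapping.lookup c (h i)))"
      by (auto simp: rep_chain_def f_def m_def intro!: sum.cong)
    also have "\<dots> = c"
      using sum.reindex_bij_betw[OF h, of "\<lambda>x. Poly_Mapping.single x (Poly_Mapping.lookup c x)"]
      by (simp add: sum_single_lookup)
    finally show ?thesis .
  qed
  ultimately show ?thesis using enum by (auto simp: chain_elt_def colim_rep_def)
qed

lemma chain_elt_inject:
  assumes "chain_elt r q X c = chain_elt r q X d" "c \<in> rchains q X" "l1norm c < r"
  shows "c = d"
  using chain_elt_nonempty[OF assms(2,3)] assms(1) by (auto simp: chain_elt_def)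

lemma sm_ext_cells:
  "sm_ext (norm_HR r) (cells q X) (None, 0) = chain_elt r q X ` {c \<in> rchains q X. l1norm c < r}"
proof (intro equalityI subsetI)
  fix z assume "z \<in> sm_ext (norm_HR r) (cells q X) (None, 0)"
  then obtain s where "s \<in> pre_rep r q X" "z = colim_class (norm_HR r) (cells q X) (None, 0) s"
    using colim_rep_pre_rep unfolding sm_ext_def by blast
  then show "z \<in> chain_elt r q X ` {c \<in> rchains q X. l1norm c < r}"
    using rep_chain_bounds[of s r q X] by (simp add: colim_class_eq)
next
  fix z assume "z \<in> chain_elt r q X ` {c \<in> rchains q X. l1norm c < r}"
  then obtain c where c: "c \<in> rchains q X" "l1norm c < r" "z = chain_elt r q X c" by auto
  obtain s where s: "s \<in> chain_elt r q X c" using chain_elt_nonempty[OF c(1,2)] by blast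
  then have "s \<in> colim_rep (norm_HR r) (cells q X) (None, 0)" "rep_chain s = c"
    by (auto simp: chain_elt_def)
  then show "z \<in> sm_ext (norm_HR r) (cells q X) (None, 0)"
    using colim_class_eq[of s r q X] colim_rep_pre_rep c(3) unfolding sm_ext_def by blast
qed

lemma sm_ext_pt_cells:
  assumes "0 < r"
  shows "sm_ext_pt (norm_HR r) (cells q X) (None, 0) = chain_elt r q X 0"
proof -
  let ?s = "(0, \<lambda>_. (None, 0), sm_pt (norm_HR r) 0)"
  have "?s \<in> pre_rep r q X"
    using assms by (auto simp: pre_rep_def cells_def norm_HR_def HR_def)
  from colim_class_eq[OF this] show ?thesis
    by (simp add: sm_ext_pt_def rep_chain_def)
qed

section \<open>Simplices, base points and faces of the simplicial set of bounded chains\<close>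

abbreviation HRX :: "real \<Rightarrow> 'a topology \<Rightarrow>
    (nat \<times> (nat \<Rightarrow> ((nat \<Rightarrow> real) \<Rightarrow> 'a) option \<times> nat) \<times> (nat \<Rightarrow> real)) set psset" where
  "HRX r X \<equiv> sm_comp (norm_HR r) (smash (sing_plus X) (Suc 0))"

lemma simplices_HRX: "simplices (HRX r X) q = chain_elt r q X ` {c \<in> rchains q X. l1norm c < r}"
  by (simp add: sm_comp_def pt_smash_sing_plus simplices_smash_sing_plus sm_ext_cells)

lemma pt_HRX: "0 < r \<Longrightarrow> pt (HRX r X) q = chain_elt r q X 0"
  by (simp add: sm_comp_def pt_smash_sing_plus simplices_smash_sing_plus sm_ext_pt_cells)

text \<open>\<open>sm_ext_map\<close> takes a union over all representatives. Each of them yields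
  the class of the face of \<open>c\<close>, because \<open>?\<phi>\<close> acts on cells as
  \<open>sact\<close> does, and the union collapses since \<open>l1norm c < r\<close> makes it
  nonempty.\<close>

lemma face_HRX:
  assumes c: "c \<in> rchains (Suc q) X" "l1norm c < r"
  shows "face (HRX r X) q j (chain_elt r (Suc q) X c) = chain_elt r q X (rface q j c)"
proof -
  let ?\<phi> = "act (smash (sing_plus X) (Suc 0)) q (Suc q) (coface j)"
  have \<phi>0: "?\<phi> (None, 0) = (None, 0)"
    and \<phi>1: "?\<phi> (Some \<sigma>, Suc 0) = (Some (sact q (coface j) \<sigma>), Suc 0)" for \<sigma>
    by (auto simp: smash_def sing_plus_def smash_norm_def sact_def)
  have *: "colim_class (norm_HR r) (cells q X) (None, 0) (k, ?\<phi> \<circ> f, m) = chain_elt r q X (rface q j c)"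
    if s: "(k, f, m) \<in> chain_elt r (Suc q) X c" for k f m
  proof -
    have pre: "(k, f, m) \<in> pre_rep r (Suc q) X" and eq: "rep_chain (k, f, m) = c"
      using s colim_rep_pre_rep by (auto simp: chain_elt_def)
    have \<phi>: "?\<phi> y \<in> cells q X \<and> cell_chain (?\<phi> y) t = rface q j (cell_chain y t)"
      if "y \<in> cells (Suc q) X" for y t
      using that singular_simplex_sact[OF coface_image]
      by (cases rule: cells_cases) (simp_all add: \<phi>0 \<phi>1)
    have f: "f i \<in> cells (Suc q) X" if "i \<le> k" for i using pre that by (auto simp: pre_rep_def)
    have "(k, ?\<phi> \<circ> f, m) \<in> pre_rep r q X"
      using pre \<phi>0 \<phi> f by (simp add: pre_rep_def image_subset_iff)
    moreover have "rep_chain (k, ?\<phi> \<circ> f, m) = rface q j c"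
      unfolding eq[symmetric] rep_chain_def prod.case push_sum using \<phi> f by (intro sum.cong) auto
    ultimately show ?thesis by (simp add: colim_class_eq)
  qed
  have "face (HRX r X) q j (chain_elt r (Suc q) X c)
      = (\<Union>(k, f, m)\<in>chain_elt r (Suc q) X c. colim_class (norm_HR r) (cells q X) (None, 0) (k, ?\<phi> \<circ> f, m))"
    by (simp add: face_def sm_comp_def sm_ext_map_def pt_smash_sing_plus simplices_smash_sing_plus)
  also have "\<dots> = (\<Union>s\<in>chain_elt r (Suc q) X c. chain_elt r q X (rface q j c))"
    using * by (intro SUP_cong) auto
  also have "\<dots> = chain_elt r q X (rface q j c)"
    using chain_elt_nonempty[OF c] by simp
  finally show ?thesis .
qed

text \<open>In an injective enumeration only index 0 meets the base point, so \<open>the\<close> is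
  applied to genuine simplices and every representative gives the same sum, as
  \<open>the_elem\<close> requires.\<close>

lemma chain_of_chain_elt:
  assumes "c \<in> rchains q X" "l1norm c < r"
  shows "chain_of (chain_elt r q X c) = c"
proof -
  have "(\<lambda>(k, f, m). \<Sum>i=1..k. Poly_Mapping.single (the (fst (f i))) (m i)) s = c"
    if s: "s \<in> chain_elt r q X c" for s
  proof -
    obtain k f m where sk: "s = (k, f, m)" by (metis prod_cases3)
    have f: "inj_on f {..k}" "f 0 = (None, 0)" "f ` {..k} \<subseteq> cells q X" and eq: "rep_chain (k, f, m) = c"
      using s by (auto simp: chain_elt_def colim_rep_def enumerates_def sk)
    have "Poly_Mapping.single (the (fst (f i))) (m i) = cell_chain (f i) (m i)" if "i \<in> {1..k}" for i
    proof -
      have "f i \<noteq> f 0" using f(1) that by (auto simp: inj_on_def)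
      moreover have "f i \<in> cells q X" using f(3) that by auto
      ultimately show ?thesis unfolding f(2) cells_def by auto
    qed
    then show ?thesis using eq by (simp add: sk rep_chain_def)
  qed
  then have "(\<lambda>(k, f, m). \<Sum>i=1..k. Poly_Mapping.single (the (fst (f i))) (m i)) ` chain_elt r q X c = {c}"
    using chain_elt_nonempty[OF assms] by auto
  then show ?thesis unfolding chain_of_def by simp
qed


section \<open>The filtration by normalised cycles\<close>

lemma norm_rface_less: "l1norm c < r \<Longrightarrow> l1norm (rface q j c) < r"
  using l1norm_push[of "sact q (coface j)" c] by simp

text \<open>The base point is the element of the zero chain. Injectivity of \<open>chain_elt\<close>
  is available because faces do not leave the ball of radius \<open>r\<close>.\<close>

lemma face_HRX_pt_iff:
  assumes "0 < r" "c \<in> rchains (Suc q) X" "l1norm c < r"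
  shows "face (HRX r X) q j (chain_elt r (Suc q) X c) = pt (HRX r X) q \<longleftrightarrow> rface q j c = 0"
  unfolding face_HRX[OF assms(2,3)] pt_HRX[OF assms(1)]
  using chain_elt_inject[OF _ rchains_rface[OF assms(2)] norm_rface_less[OF assms(3)]] by metis

lemma Zcomb_HRX:
  assumes "0 < r"
  shows "Zcomb (HRX r X) n = chain_elt r n X ` {c \<in> normalised_cycles n X. l1norm c < r}"
proof -
  have "(\<forall>j\<le>n. face (HRX r X) (n - 1) j (chain_elt r n X c) = pt (HRX r X) (n - 1))
      \<longleftrightarrow> (\<forall>j\<le>n. rface (n - 1) j c = 0)"
    if "c \<in> rchains n X" "l1norm c < r" "n \<noteq> 0" for c
    using face_HRX_pt_iff[OF assms, of c "n - 1" X] that by simp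
  then show ?thesis
    unfolding Zcomb_def simplices_HRX normalised_cycles_def by blast
qed

text \<open>A simplex witnessing the relation is a chain whose only possibly nonzero faces are the
  last two, with opposite signs; its boundary is therefore the difference of the two chains up to
  sign.\<close>

lemma Rcomb_HRX_hclass:
  assumes r: "0 < r" and R: "Rcomb (HRX r X) n x y"
  shows "hclass n X (chain_of x) = hclass n X (chain_of y)"
proof -
  obtain w where w: "w \<in> rchains (Suc n) X" "l1norm w < r"
    and faces: "\<forall>j<n. face (HRX r X) n j (chain_elt r (Suc n) X w) = pt (HRX r X) n"
    and xy': "face (HRX r X) n n (chain_elt r (Suc n) X w) = x"
      "face (HRX r X) n (Suc n) (chain_elt r (Suc n) X w) = y"
    using R unfolding Rcomb_def simplices_HRX by blast
  have pt: "rface n j w = 0" if "j < n" for j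
    using faces that face_HRX_pt_iff[OF r w] by blast
  have xy: "x = chain_elt r n X (rface n n w)" "y = chain_elt r n X (rface n (Suc n) w)"
    using xy' face_HRX[OF w] by auto
  have ch: "chain_of x = rface n n w" "chain_of y = rface n (Suc n) w"
    unfolding xy using rchains_rface[OF w(1)] norm_rface_less[OF w(2)] by (auto simp: chain_of_chain_elt)
  have "(\<Sum>j<n. smul ((-1) ^ j) (rface n j w)) = 0"
    using pt by (intro sum.neutral) auto
  moreover have "{..Suc n} = insert (Suc n) (insert n {..<n})" by auto
  ultimately have "rboundary (Suc n) w = smul ((-1) ^ n) (chain_of x - chain_of y)"
    by (simp add: rboundary_Suc ch smul_minus smul_diff del: sum.atMost_Suc)
  then have "smul ((-1) ^ n) (chain_of x - chain_of y) \<in> rboundaries n X"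
    unfolding rboundaries_def using w(1) by (metis image_eqI)
  from rboundaries_smul[OF this, of "(-1) ^ n"] show ?thesis
    by (intro hclass_eqI) (simp add: smul_smul)
qed

lemma canonical_map_comb_class:
  assumes r: "0 < r" and x: "x \<in> Zcomb (HRX r X) n"
  shows "canonical_map n X (comb_class (HRX r X) n x) = hclass n X (chain_of x)"
proof -
  have eq: "hclass n X (chain_of y) = hclass n X (chain_of x)" if "equivclp (Rcomb (HRX r X) n) x y" for y
    using that
  proof (induction rule: equivclp_induct)
    case (step y z)
    then show ?case using Rcomb_HRX_hclass[OF r] by metis
  qed simp
  have "x \<in> comb_class (HRX r X) n x" using x by (simp add: comb_class_def)
  then show ?thesis
    unfolding canonical_map_def
    by (intro SUP_eq_const) (use eq in \<open>unfold comb_class_def, blast+\<close>)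
qed

text \<open>This reduces the filtration to chains: what follows uses the s-modules and combinatorial
  homotopy only through this description.\<close>

lemma filt_eq:
  assumes "0 < r"
  shows "filt n X r = hclass n X ` {c \<in> normalised_cycles n X. l1norm c < r}"
proof -
  have "filt n X r = (\<lambda>x. canonical_map n X (comb_class (HRX r X) n x)) ` Zcomb (HRX r X) n"
    by (simp add: filt_def Hn_def pi_comb_def image_image)
  also have "\<dots> = (\<lambda>x. hclass n X (chain_of x)) ` Zcomb (HRX r X) n"
    using canonical_map_comb_class[OF assms] by (intro image_cong) auto
  also have "\<dots> = hclass n X ` {c \<in> normalised_cycles n X. l1norm c < r}"
    unfolding Zcomb_HRX[OF assms] image_image
    by (intro image_cong) (auto simp: chain_of_chain_elt normalised_cycles_def)
  finally show ?thesis .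
qed

section \<open>Linear structure on normalised cycles and on homology\<close>

lemma rcycles_smul: "a \<in> rcycles n X \<Longrightarrow> smul t a \<in> rcycles n X"
  by (auto simp: rcycles_def rchains_smul rboundary_smul)

lemma normalised_cycles_add:
  "a \<in> normalised_cycles n X \<Longrightarrow> b \<in> normalised_cycles n X \<Longrightarrow> a + b \<in> normalised_cycles n X"
  by (auto simp: normalised_cycles_def rchains_add push_add)

lemma normalised_cycles_smul: "a \<in> normalised_cycles n X \<Longrightarrow> smul t a \<in> normalised_cycles n X"
  by (auto simp: normalised_cycles_def rchains_smul push_smul)

lemma normalised_cycles_zero: "0 \<in> normalised_cycles n X"
  by (auto simp: normalised_cycles_def)

lemma hclass_self: "a \<in> rcycles n X \<Longrightarrow> a \<in> hclass n X a"
  by (simp add: hclass_def)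

lemma hclass_member: "c \<in> hclass n X a \<Longrightarrow> hclass n X c = hclass n X a"
  by (intro hclass_eqI) (simp add: hclass_def)

lemma hadd_hclass:
  assumes "a \<in> rcycles n X" "b \<in> rcycles n X"
  shows "hadd n X (hclass n X a) (hclass n X b) = hclass n X (a + b)"
proof -
  have eq: "hclass n X (a' + b') = hclass n X (a + b)" if "a' \<in> hclass n X a" "b' \<in> hclass n X b" for a' b'
    using that rboundaries_add[of "a' - a" n X "b' - b"]
    by (intro hclass_eqI) (auto simp: hclass_def algebra_simps)
  show ?thesis
    unfolding hadd_def
  proof (rule SUP_eq_const)
    show "hclass n X a \<noteq> {}" using hclass_self[OF assms(1)] by auto
    fix a' assume "a' \<in> hclass n X a"
    from eq[OF this] show "(\<Union>b'\<in>hclass n X b. hclass n X (a' + b')) = hclass n X (a + b)"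
      using hclass_self[OF assms(2)] by (intro SUP_eq_const) auto
  qed
qed

lemma hscale_hclass:
  assumes "a \<in> rcycles n X"
  shows "hscale n X t (hclass n X a) = hclass n X (smul t a)"
proof -
  have eq: "hclass n X (smul t a') = hclass n X (smul t a)" if "a' \<in> hclass n X a" for a'
    using that rboundaries_smul[of "a' - a" n X t]
    by (intro hclass_eqI) (auto simp: hclass_def smul_diff)
  then show ?thesis
    unfolding hscale_def using hclass_self[OF assms] by (intro SUP_eq_const) blast+
qed


section \<open>The two seminorms\<close>

text \<open>The bound defining a step is strict, so \<open>l1norm c + e\<close> is admissible for
  every \<open>e > 0\<close>, and the claim follows in the limit.\<close>

lemma filt_norm_le:
  assumes "c \<in> normalised_cycles n X"
  shows "filt_norm n X (hclass n X c) \<le> l1norm c"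
proof (rule field_le_epsilon)
  fix e :: real assume "0 < e"
  then have "0 < l1norm c + e" using l1norm_nonneg[of c] by simp
  then have "l1norm c + e \<in> {r. 0 < r \<and> hclass n X c \<in> filt n X r}"
    using assms \<open>0 < e\<close> by (auto simp: filt_eq)
  then show "filt_norm n X (hclass n X c) \<le> l1norm c + e"
    unfolding filt_norm_def by (intro cInf_lower) (auto intro: bdd_belowI[of _ 0])
qed

text \<open>Normalised representatives make the set under the infimum nonempty, so that
  \<open>Inf\<close> is a genuine infimum and can be approached from above.\<close>

lemma filt_norm_approx:
  assumes \<alpha>: "\<alpha> \<in> rhomology n X" and less: "filt_norm n X \<alpha> < s"
  obtains c where "c \<in> normalised_cycles n X" "\<alpha> = hclass n X c" "l1norm c < s"
proof -
  obtain a where a: "a \<in> rcycles n X" "\<alpha> = hclass n X a" using \<alpha> by (auto simp: rhomology_def)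
  obtain c where c: "c \<in> normalised_cycles n X" "\<alpha> = hclass n X c"
    using normalised_representative[OF a(1)] a(2) by auto
  have "0 < l1norm c + 1" using l1norm_nonneg[of c] by simp
  then have "l1norm c + 1 \<in> {r. 0 < r \<and> \<alpha> \<in> filt n X r}"
    using c by (auto simp: filt_eq)
  then have "{r. 0 < r \<and> \<alpha> \<in> filt n X r} \<noteq> {}" by blast
  from cInf_lessD[OF this] less obtain r where "0 < r" "\<alpha> \<in> filt n X r" "r < s"
    unfolding filt_norm_def by blast
  then show thesis using that by (auto simp: filt_eq)
qed

lemma filt_norm_nonneg:
  assumes "\<alpha> \<in> rhomology n X"
  shows "0 \<le> filt_norm n X \<alpha>"
proof (rule ccontr)
  assume "\<not> 0 \<le> filt_norm n X \<alpha>"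
  then obtain c :: "'a rchain" where "l1norm c < 0"
    using filt_norm_approx[OF assms, of 0] by auto
  then show False using l1norm_nonneg[of c] by simp
qed

lemma rhomology_cases:
  assumes "\<alpha> \<in> rhomology n X"
  obtains a where "a \<in> rcycles n X" "\<alpha> = hclass n X a"
  using assms by (auto simp: rhomology_def)

lemma rhomology_hscale: "\<alpha> \<in> rhomology n X \<Longrightarrow> hscale n X t \<alpha> \<in> rhomology n X"
  by (auto simp: rhomology_def hscale_hclass rcycles_smul)

lemma filt_norm_hscale_le:
  assumes \<alpha>: "\<alpha> \<in> rhomology n X" and "t \<noteq> 0"
  shows "filt_norm n X (hscale n X t \<alpha>) \<le> \<bar>t\<bar> * filt_norm n X \<alpha>"
proof (rule field_le_epsilon)
  fix e :: real assume "0 < e"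
  then have "filt_norm n X \<alpha> < filt_norm n X \<alpha> + e / \<bar>t\<bar>" using \<open>t \<noteq> 0\<close> by simp
  then obtain c where c: "c \<in> normalised_cycles n X" "\<alpha> = hclass n X c"
    "l1norm c < filt_norm n X \<alpha> + e / \<bar>t\<bar>"
    using filt_norm_approx[OF \<alpha>] by blast
  have "hscale n X t \<alpha> = hclass n X (smul t c)"
    unfolding c(2) by (rule hscale_hclass[OF subsetD[OF normalised_cycles_subset c(1)]])
  then have "filt_norm n X (hscale n X t \<alpha>) \<le> \<bar>t\<bar> * l1norm c"
    using filt_norm_le[OF normalised_cycles_smul[OF c(1)]] by (simp add: l1norm_smul)
  also have "\<dots> \<le> \<bar>t\<bar> * (filt_norm n X \<alpha> + e / \<bar>t\<bar>)"
    using c(3) by (intro mult_left_mono) auto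
  also have "\<dots> = \<bar>t\<bar> * filt_norm n X \<alpha> + e" using \<open>t \<noteq> 0\<close> by (simp add: field_simps)
  finally show "filt_norm n X (hscale n X t \<alpha>) \<le> \<bar>t\<bar> * filt_norm n X \<alpha> + e" .
qed

text \<open>For \<open>t \<noteq> 0\<close> the reverse inequality is obtained by scaling back with
  \<open>1 / t\<close>; for \<open>t = 0\<close> the class is represented by the zero chain.\<close>

lemma filt_norm_hscale:
  assumes \<alpha>: "\<alpha> \<in> rhomology n X"
  shows "filt_norm n X (hscale n X t \<alpha>) = \<bar>t\<bar> * filt_norm n X \<alpha>"
proof (cases "t = 0")
  case True
  have "hscale n X 0 \<alpha> = hclass n X 0"
    using \<alpha> by (auto simp: rhomology_def hscale_hclass)
  then show ?thesis
    using True filt_norm_le[OF normalised_cycles_zero, of n X]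
      filt_norm_nonneg[OF rhomology_hscale[OF \<alpha>, of 0]] by simp
next
  case False
  have "hscale n X (1 / t) (hscale n X t \<alpha>) = \<alpha>"
    using \<alpha> False by (auto simp: rhomology_def hscale_hclass rcycles_smul smul_smul)
  then have "filt_norm n X \<alpha> \<le> \<bar>1 / t\<bar> * filt_norm n X (hscale n X t \<alpha>)"
    using filt_norm_hscale_le[OF rhomology_hscale[OF \<alpha>, of t], of "1 / t"] False by simp
  then have "\<bar>t\<bar> * filt_norm n X \<alpha> \<le> filt_norm n X (hscale n X t \<alpha>)"
    using False by (simp add: field_simps)
  then show ?thesis using filt_norm_hscale_le[OF \<alpha> False] by simp
qed

lemma filt_norm_hadd:
  assumes \<alpha>: "\<alpha> \<in> rhomology n X" and \<beta>: "\<beta> \<in> rhomology n X"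
  shows "filt_norm n X (hadd n X \<alpha> \<beta>) \<le> filt_norm n X \<alpha> + filt_norm n X \<beta>"
proof (rule field_le_epsilon)
  fix e :: real assume "0 < e"
  then have less: "filt_norm n X \<alpha> < filt_norm n X \<alpha> + e / 2" "filt_norm n X \<beta> < filt_norm n X \<beta> + e / 2"
    by auto
  obtain a where a: "a \<in> normalised_cycles n X" "\<alpha> = hclass n X a" "l1norm a < filt_norm n X \<alpha> + e / 2"
    using filt_norm_approx[OF \<alpha> less(1)] by blast
  obtain b where b: "b \<in> normalised_cycles n X" "\<beta> = hclass n X b" "l1norm b < filt_norm n X \<beta> + e / 2"
    using filt_norm_approx[OF \<beta> less(2)] by blast
  have "hadd n X \<alpha> \<beta> = hclass n X (a + b)"
    unfolding a(2) b(2)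
    by (rule hadd_hclass[OF subsetD[OF normalised_cycles_subset a(1)] subsetD[OF normalised_cycles_subset b(1)]])
  then have "filt_norm n X (hadd n X \<alpha> \<beta>) \<le> l1norm (a + b)"
    using filt_norm_le[OF normalised_cycles_add[OF a(1) b(1)]] by simp
  also have "\<dots> \<le> l1norm a + l1norm b" by (rule l1norm_add)
  finally show "filt_norm n X (hadd n X \<alpha> \<beta>) \<le> filt_norm n X \<alpha> + filt_norm n X \<beta> + e"
    using a(3) b(3) by simp
qed

text \<open>Each cycle in the class can be normalised at the cost of \<open>2 ^ n\<close>. Dividing
  by this factor gives a lower bound for all norms in the class, hence for their infimum.\<close>

lemma filt_norm_le_gromov_norm:
  assumes \<alpha>: "\<alpha> \<in> rhomology n X"
  shows "filt_norm n X \<alpha> \<le> 2 ^ n * gromov_norm \<alpha>"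
proof -
  have "filt_norm n X \<alpha> / 2 ^ n \<le> l1norm a" if "a \<in> \<alpha>" for a
  proof -
    obtain b where b: "\<alpha> = hclass n X b" using \<alpha> by (rule rhomology_cases)
    have a: "a \<in> rcycles n X" "\<alpha> = hclass n X a"
      using that hclass_member[of a n X b] by (auto simp: b hclass_def)
    obtain c where c: "c \<in> normalised_cycles n X" "hclass n X c = \<alpha>" "l1norm c \<le> 2 ^ n * l1norm a"
      using normalised_representative[OF a(1)] a(2) by auto
    have "filt_norm n X \<alpha> \<le> 2 ^ n * l1norm a"
      using filt_norm_le[OF c(1)] c(2,3) by simp
    then show ?thesis by (simp add: field_simps)
  qed
  moreover have "\<alpha> \<noteq> {}" using \<alpha> hclass_self by (auto simp: rhomology_def)
  ultimately have "filt_norm n X \<alpha> / 2 ^ n \<le> gromov_norm \<alpha>"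
    unfolding gromov_norm_def by (intro cInf_greatest) auto
  then show ?thesis by (simp add: field_simps)
qed

text \<open>Normalised cycles are among the cycles competing in the Gromov infimum, so no constant
  is lost.\<close>

lemma gromov_norm_le_filt_norm:
  assumes \<alpha>: "\<alpha> \<in> rhomology n X"
  shows "gromov_norm \<alpha> \<le> filt_norm n X \<alpha>"
proof (rule field_le_epsilon)
  fix e :: real assume "0 < e"
  then obtain c where c: "c \<in> normalised_cycles n X" "\<alpha> = hclass n X c" "l1norm c < filt_norm n X \<alpha> + e"
    using filt_norm_approx[OF \<alpha>, of "filt_norm n X \<alpha> + e"] by auto
  have "c \<in> \<alpha>" using c normalised_cycles_subset hclass_self by blast
  then have "gromov_norm \<alpha> \<le> l1norm c"
    unfolding gromov_norm_def by (intro cInf_lower) (auto intro!: bdd_belowI[of _ 0] l1norm_nonneg)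
  then show "gromov_norm \<alpha> \<le> filt_norm n X \<alpha> + e" using c(3) by simp
qed

section \<open>Monotonicity and exhaustion of the filtration, and the conclusion\<close>

lemma filt_mono:
  assumes "0 < r" "r \<le> s"
  shows "filt n X r \<subseteq> filt n X s"
  using assms by (auto simp: filt_eq)

lemma Union_filt: "(\<Union>r\<in>{0<..}. filt n X r) = rhomology n X"
proof (intro equalityI subsetI)
  fix \<alpha> assume "\<alpha> \<in> rhomology n X"
  then obtain c where c: "c \<in> normalised_cycles n X" "\<alpha> = hclass n X c"
    \<comment> \<open>Any bound above the filtration norm serves here; only the existence of a
      normalised representative matters.\<close>
    using filt_norm_approx[of \<alpha> n X "filt_norm n X \<alpha> + 1"] by auto
  have "0 < l1norm c + 1" using l1norm_nonneg[of c] by simp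
  moreover from this have "\<alpha> \<in> filt n X (l1norm c + 1)" using c by (auto simp: filt_eq)
  ultimately show "\<alpha> \<in> (\<Union>r\<in>{0<..}. filt n X r)" by blast
qed (use normalised_cycles_subset in \<open>auto simp: filt_eq rhomology_def\<close>)

text \<open>The first two conjuncts express that the ranges form an increasing, exhaustive
  filtration of homology.\<close>

theorem corollary3p6:
  fixes X :: "'a topology" and n :: nat
  shows "(\<forall>r s. 0 < r \<and> r \<le> s \<longrightarrow> filt n X r \<subseteq> filt n X s) \<and>
    (\<Union>r\<in>{0<..}. filt n X r) = rhomology n X \<and>
    seminorm_on (rhomology n X) (hadd n X) (hscale n X) (filt_norm n X) \<and>
    equivalent_seminorms (rhomology n X) (filt_norm n X) gromov_norm"
proof (intro conjI)
  show "\<forall>r s. 0 < r \<and> r \<le> s \<longrightarrow> filt n X r \<subseteq> filt n X s"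
    using filt_mono by blast
  show "(\<Union>r\<in>{0<..}. filt n X r) = rhomology n X"
    by (rule Union_filt)
  show "seminorm_on (rhomology n X) (hadd n X) (hscale n X) (filt_norm n X)"
    unfolding seminorm_on_def using filt_norm_nonneg filt_norm_hscale filt_norm_hadd by blast
  show "equivalent_seminorms (rhomology n X) (filt_norm n X) gromov_norm"
    unfolding equivalent_seminorms_def
    using filt_norm_le_gromov_norm gromov_norm_le_filt_norm
    by (intro conjI exI[of _ "2 ^ n"] exI[of _ 1]) auto
qed

end
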